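(* Let $\xi_i=(\mathcal{E}_i,p_i,T)$, $i=1,2$, be Banach bundles with $T$ paracompact, and let $\varphi:\mathcal{E}_1\to\mathcal{E}_2$ be a Banach bundle map from $\xi_1$ to $\xi_2$ which is an open map and satisfies $\varphi(\mathcal{E}_1)=\mathcal{E}_2$. Then $\tilde{\varphi}(\Gamma(\xi_1))=\Gamma(\xi_2)$.
   Context: $\mathbb{K}$ is the real or the complex field. A Banach bundle $\xi=(\mathcal{E},p,T)$ consists of a Hausdorff space $T$ (base space), a topological space $\mathcal{E}$ (bundle space, not assumed Hausdorff), and a continuous open surjection $p:\mathcal{E}\to T$ such that each fiber $\mathcal{E}(t)=p^{-1}(t)$ is a Banach space over $\mathbb{K}$ with origin $0_t$, and: addition $\{(x,y)\in\mathcal{E}\times\mathcal{E}: p(x)=p(y)\}\to\mathcal{E}$ and scalar multiplication $\mathbb{K}\times\mathcal{E}\to\mathcal{E}$ are continuous; $x\mapsto\|x\|$ is upper semi-continuous on $\mathcal{E}$; and if $(x_\iota)$ is a net in $\mathcal{E}$ with $p(x_\iota)\to t$ and $\|x_\iota\|\to 0$, then $x_\iota\to 0_t$. Paracompact spaces are assumed Hausdorff. A section of $\xi$ is a continuous $f:T\to\mathcal{E}$ with $p(f(t))=t$ for all $t\in T$; $\Gamma(\xi)$ is the linear space of all sections. A Banach bundle map from $\xi_1$ to $\xi_2$ is a continuous map $\varphi:\mathcal{E}_1\to\mathcal{E}_2$ with $\varphi(p_1^{-1}(t))\subset p_2^{-1}(t)$ for every $t\in T$ whose restriction to each fiber is linear.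 It induces the linear map $\tilde\varphi:\Gamma(\xi_1)\to\Gamma(\xi_2)$, $\tilde\varphi(f)(t)=\varphi(f(t))$. *)

theory Defs
  imports "HOL-Analysis.Analysis"
begin

text \<open>
  The scalar field \<open>\<K>\<close>: a (multiplicatively) normed field extending the reals that is either
  the reals or has the form \<open>\<real> + \<real>i\<close> with \<open>i\<^sup>2 = -1\<close>. Multiplicativity of the norm makes
  the identification with the real or complex numbers isometric.
\<close>

class real_or_complex = real_normed_field +
  assumes real_or_complex:
    "(\<forall>z. \<exists>a. z = scaleR a 1) \<or>
     (\<exists>i. i * i = - 1 \<and> (\<forall>z. \<exists>a b. z = scaleR a 1 + scaleR b i))"

instance real :: real_or_complex
  by standard simp

instance complex :: real_or_complex
proof
  have "\<i> * \<i> = - 1 \<and> (\<forall>z. \<exists>a b. z = scaleR a 1 + scaleR b \<i>)"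
    by (auto simp: complex_eq_iff)
  then show "(\<forall>z::complex. \<exists>a. z = scaleR a 1) \<or>
     (\<exists>i::complex. i * i = - 1 \<and> (\<forall>z. \<exists>a b. z = scaleR a 1 + scaleR b i))"
    by blast
qed

definition paracompact_space :: "'a topology \<Rightarrow> bool" where
  "paracompact_space X \<longleftrightarrow>
     Hausdorff_space X \<and>
     (\<forall>\<U>. (\<forall>U\<in>\<U>. openin X U) \<and> \<Union>\<U> = topspace X \<longrightarrow>
        (\<exists>\<V>. (\<forall>V\<in>\<V>. openin X V) \<and> \<Union>\<V> = topspace X \<and>
             (\<forall>V\<in>\<V>. \<exists>U\<in>\<U>. V \<subseteq> U) \<and> locally_finite_in X \<V>))"

text \<open>
  A Banach space whose underlying set is \<open>V\<close>; the operations are unconstrained outside \<open>V\<close>.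
  The difference of \<open>x\<close> and \<open>y\<close> is written \<open>add x (smul (- 1) y)\<close>.
\<close>

locale banach_space_on =
  fixes V :: "'e set"
    and add :: "'e \<Rightarrow> 'e \<Rightarrow> 'e"
    and smul :: "'k::real_or_complex \<Rightarrow> 'e \<Rightarrow> 'e"
    and orig :: 'e
    and nrm :: "'e \<Rightarrow> real"
  assumes orig_closed: "orig \<in> V"
    and add_closed: "\<lbrakk>x \<in> V; y \<in> V\<rbrakk> \<Longrightarrow> add x y \<in> V"
    and smul_closed: "x \<in> V \<Longrightarrow> smul c x \<in> V"
    and add_assoc: "\<lbrakk>x \<in> V; y \<in> V; z \<in> V\<rbrakk> \<Longrightarrow> add (add x y) z = add x (add y z)"
    and add_comm: "\<lbrakk>x \<in> V; y \<in> V\<rbrakk> \<Longrightarrow> add x y = add y x"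
    and add_orig: "x \<in> V \<Longrightarrow> add x orig = x"
    and add_inverse: "x \<in> V \<Longrightarrow> \<exists>y\<in>V. add x y = orig"
    and smul_add_right: "\<lbrakk>x \<in> V; y \<in> V\<rbrakk> \<Longrightarrow> smul c (add x y) = add (smul c x) (smul c y)"
    and smul_add_left: "x \<in> V \<Longrightarrow> smul (c + d) x = add (smul c x) (smul d x)"
    and smul_smul: "x \<in> V \<Longrightarrow> smul c (smul d x) = smul (c * d) x"
    and smul_one: "x \<in> V \<Longrightarrow> smul 1 x = x"
    and nrm_nonneg: "x \<in> V \<Longrightarrow> 0 \<le> nrm x"
    and nrm_eq_0: "x \<in> V \<Longrightarrow> nrm x = 0 \<longleftrightarrow> x = orig"
    and nrm_triangle: "\<lbrakk>x \<in> V; y \<in> V\<rbrakk> \<Longrightarrow> nrm (add x y) \<le> nrm x + nrm y"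
    and nrm_smul: "x \<in> V \<Longrightarrow> nrm (smul c x) = norm c * nrm x"
    and complete:
      "\<lbrakk>\<And>n::nat. \<sigma> n \<in> V;
        \<And>e. 0 < e \<Longrightarrow> \<exists>N. \<forall>m\<ge>N. \<forall>n\<ge>N. nrm (add (\<sigma> m) (smul (- 1) (\<sigma> n))) < e\<rbrakk>
       \<Longrightarrow> \<exists>l\<in>V. (\<lambda>n. nrm (add (\<sigma> n) (smul (- 1) l))) \<longlonglongrightarrow> 0"

text \<open>
  The data of a bundle: bundle space, base space, projection, and the fiberwise operations. Addition
  is only meaningful for two points of the same fiber.
\<close>

record ('k, 'e, 't) bundle_data =
  tot_space :: "'e topology"
  base_space :: "'t topology"
  proj :: "'e \<Rightarrow> 't"
  badd :: "'e \<Rightarrow> 'e \<Rightarrow> 'e"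
  bsmul :: "'k \<Rightarrow> 'e \<Rightarrow> 'e"
  borig :: "'t \<Rightarrow> 'e"
  bnorm :: "'e \<Rightarrow> real"

definition fiber :: "('k, 'e, 't) bundle_data \<Rightarrow> 't \<Rightarrow> 'e set" where
  "fiber \<xi> t = {x \<in> topspace (tot_space \<xi>). proj \<xi> x = t}"

text \<open>
  In \<open>norm_net\<close> nets are rendered by filters: all the conditions on a net in \<open>\<E>\<close> depend only on the
  image in \<open>\<E>\<close> of its filter of tails, and every proper filter arises from a net in this way.
\<close>

locale banach_bundle =
  fixes \<xi> :: "('k::real_or_complex, 'e, 't) bundle_data"
  assumes Hausdorff_base: "Hausdorff_space (base_space \<xi>)"
    and proj_continuous: "continuous_map (tot_space \<xi>) (base_space \<xi>) (proj \<xi>)"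
    and proj_open: "open_map (tot_space \<xi>) (base_space \<xi>) (proj \<xi>)"
    and proj_surj: "proj \<xi> ` topspace (tot_space \<xi>) = topspace (base_space \<xi>)"
    and fiber_banach: "t \<in> topspace (base_space \<xi>) \<Longrightarrow>
          banach_space_on (fiber \<xi> t) (badd \<xi>) (bsmul \<xi>) (borig \<xi> t) (bnorm \<xi>)"
    and add_continuous:
          "continuous_map
             (subtopology (prod_topology (tot_space \<xi>) (tot_space \<xi>)) {(x, y). proj \<xi> x = proj \<xi> y})
             (tot_space \<xi>) (\<lambda>(x, y). badd \<xi> x y)"
    and smul_continuous:
          "continuous_map (prod_topology euclidean (tot_space \<xi>)) (tot_space \<xi>)
             (\<lambda>(c, x). bsmul \<xi> c x)"
    and norm_upper_semicontinuous:
          "openin (tot_space \<xi>) {x \<in> topspace (tot_space \<xi>). bnorm \<xi> x < a}"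
    and norm_net:
          "\<lbrakk>t \<in> topspace (base_space \<xi>);
            eventually (\<lambda>x. x \<in> topspace (tot_space \<xi>)) F;
            limitin (base_space \<xi>) (proj \<xi>) t F;
            (bnorm \<xi> \<longlongrightarrow> 0) F\<rbrakk>
           \<Longrightarrow> limitin (tot_space \<xi>) (\<lambda>x. x) (borig \<xi> t) F"

text \<open>
  Sections are represented by functions that are \<open>undefined\<close> off the base space, so that equality of
  functions is equality of sections.
\<close>

definition sections :: "('k, 'e, 't) bundle_data \<Rightarrow> ('t \<Rightarrow> 'e) set" where
  "sections \<xi> =
     {f \<in> extensional (topspace (base_space \<xi>)).
        continuous_map (base_space \<xi>) (tot_space \<xi>) f \<and>
        (\<forall>t\<in>topspace (base_space \<xi>). proj \<xi> (f t) = t)}"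

definition banach_bundle_map ::
    "('k, 'e, 't) bundle_data \<Rightarrow> ('k, 'f, 't) bundle_data \<Rightarrow> ('e \<Rightarrow> 'f) \<Rightarrow> bool" where
  "banach_bundle_map \<xi>\<^sub>1 \<xi>\<^sub>2 \<phi> \<longleftrightarrow>
     base_space \<xi>\<^sub>1 = base_space \<xi>\<^sub>2 \<and>
     continuous_map (tot_space \<xi>\<^sub>1) (tot_space \<xi>\<^sub>2) \<phi> \<and>
     (\<forall>t\<in>topspace (base_space \<xi>\<^sub>1).
        \<phi> ` fiber \<xi>\<^sub>1 t \<subseteq> fiber \<xi>\<^sub>2 t \<and>
        (\<forall>x\<in>fiber \<xi>\<^sub>1 t. \<forall>y\<in>fiber \<xi>\<^sub>1 t. \<phi> (badd \<xi>\<^sub>1 x y) = badd \<xi>\<^sub>2 (\<phi> x) (\<phi> y)) \<and>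
        (\<forall>c. \<forall>x\<in>fiber \<xi>\<^sub>1 t. \<phi> (bsmul \<xi>\<^sub>1 c x) = bsmul \<xi>\<^sub>2 c (\<phi> x)))"

definition induced_map ::
    "('k, 'e, 't) bundle_data \<Rightarrow> ('e \<Rightarrow> 'f) \<Rightarrow> ('t \<Rightarrow> 'e) \<Rightarrow> ('t \<Rightarrow> 'f)" where
  "induced_map \<xi>\<^sub>1 \<phi> f = (\<lambda>t\<in>topspace (base_space \<xi>\<^sub>1). \<phi> (f t))"

end

theory Submission
  imports Defs "HOL-Algebra.FiniteProduct"
begin

text \<open>
  Let \<open>g\<close> be a section of \<open>\<xi>\<^sub>2\<close>. The sets \<open>\<phi>\<^sup>-\<^sup>1(g t)\<close> are closed affine subspaces of the fibers of
  \<open>\<xi>\<^sub>1\<close>, and openness of \<open>\<phi>\<close> makes them depend lower semicontinuously on \<open>t\<close>, so a Michael-type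
  selection argument applies. As \<open>\<xi>\<^sub>1\<close> is not known in advance to have enough sections, one works with
  selections that are only continuous up to an error \<open>e\<close> measured in the fibers. Around a point \<open>x\<close>
  of the bundle space there is an open set \<open>U\<close> meeting each fiber in a set of diameter less than \<open>e\<close>,
  and any choice of lifts of \<open>g\<close> in \<open>U\<close> is a local selection with error \<open>e\<close>; a partition of
  unity glues these. Starting from a selection with error \<open>2\<^sup>-\<^sup>n\<close> and choosing \<open>U\<close> around its values,
  one gets a selection with error \<open>2\<^sup>-\<^sup>n\<^sup>-\<^sup>1\<close> within distance \<open>2 \<cdot> 2\<^sup>-\<^sup>n\<close>. The limit is a continuous lift.
\<close>

section \<open>Partitions of unity on paracompact spaces\<close>

\<comment> \<open>clashes with the topological closure\<close>
no_notation eq_closure_of (\<open>closure'_of\<index>\<close>)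

section \<open>Separation of closed sets in paracompact spaces\<close>

lemma paracompact_space_refinement:
  assumes X: "paracompact_space X" and \<U>: "\<And>U. U \<in> \<U> \<Longrightarrow> openin X U" "\<Union>\<U> = topspace X"
  obtains \<V> where "\<And>V. V \<in> \<V> \<Longrightarrow> openin X V" "\<Union>\<V> = topspace X"
    "\<And>V. V \<in> \<V> \<Longrightarrow> \<exists>U\<in>\<U>. V \<subseteq> U" "locally_finite_in X \<V>"
proof -
  have "\<exists>\<V>. (\<forall>V\<in>\<V>. openin X V) \<and> \<Union>\<V> = topspace X \<and>
      (\<forall>V\<in>\<V>. \<exists>U\<in>\<U>. V \<subseteq> U) \<and> locally_finite_in X \<V>"
    using X[unfolded paracompact_space_def, THEN conjunct2, THEN spec[of _ \<U>]] \<U> by simp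
  then show thesis
    by (elim exE conjE) (rule that; blast)
qed

text \<open>Local finiteness makes the union of the closures of the refining sets closed. The
  refining sets that meet \<open>A\<close> cover \<open>A\<close>, and each lies in some
  \<open>U\<close> separated from \<open>B\<close>, so its closure misses \<open>B\<close>; the
  complement of the union of these closures is the required neighbourhood of
  \<open>B\<close>.\<close>

lemma paracompact_space_separate:
  assumes X: "paracompact_space X" and A: "closedin X A" and B: "B \<subseteq> topspace X"
    and sep: "\<And>a. a \<in> A \<Longrightarrow> \<exists>U V. openin X U \<and> openin X V \<and> a \<in> U \<and> B \<subseteq> V \<and> disjnt U V"
  shows "\<exists>U V. openin X U \<and> openin X V \<and> A \<subseteq> U \<and> B \<subseteq> V \<and> disjnt U V"
proof -
  \<comment> \<open>The complement of \<open>A\<close> is added so that the open sets separated from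
    \<open>B\<close> become a cover of the whole space.\<close>
  define \<U> where "\<U> = insert (topspace X - A)
    {U. openin X U \<and> (\<exists>V. openin X V \<and> B \<subseteq> V \<and> disjnt U V)}"
  have "\<Union>\<U> = topspace X"
  proof
    show "\<Union>\<U> \<subseteq> topspace X"
      by (auto simp: \<U>_def dest: openin_subset)
    show "topspace X \<subseteq> \<Union>\<U>"
    proof
      fix x assume "x \<in> topspace X"
      then show "x \<in> \<Union>\<U>"
        using sep[of x] by (cases "x \<in> A") (auto simp: \<U>_def)
    qed
  qed
  moreover have "\<forall>U\<in>\<U>. openin X U"
    using A by (auto simp: \<U>_def)
  ultimately obtain \<V> where \<V>: "\<And>V. V \<in> \<V> \<Longrightarrow> openin X V" "\<Union>\<V> = topspace X"
      "\<And>V. V \<in> \<V> \<Longrightarrow> \<exists>U\<in>\<U>. V \<subseteq> U" "locally_finite_in X \<V>"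
    using paracompact_space_refinement[OF X] by (metis (lifting))
  define \<W> where "\<W> = {V\<in>\<V>. V \<inter> A \<noteq> {}}"
  have \<W>: "locally_finite_in X \<W>"
    using \<V>(4) by (rule locally_finite_in_subset) (auto simp: \<W>_def)
  have disj: "X closure_of W \<inter> B = {}" if W: "W \<in> \<W>" for W
  proof -
    obtain U where U: "U \<in> \<U>" "W \<subseteq> U"
      using W \<V>(3) by (auto simp: \<W>_def)
    then have "U \<noteq> topspace X - A"
      using W by (auto simp: \<W>_def)
    then obtain V where "openin X V" "B \<subseteq> V" "disjnt U V"
      using U by (auto simp: \<U>_def)
    then have "V \<inter> X closure_of W = {}"
      using U openin_Int_closure_of_eq_empty[of X V W] by (auto simp: disjnt_def)
    then show ?thesis
      using \<open>B \<subseteq> V\<close> by blast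
  qed
  let ?C = "\<Union>W\<in>\<W>. X closure_of W"
  have "closedin X ?C"
    using \<W> by (rule closedin_Union_locally_finite_closure)
  then have "openin X (topspace X - ?C)"
    by (simp only: openin_diff openin_topspace)
  moreover have "openin X (\<Union>\<W>)"
    using \<V>(1) by (auto simp: \<W>_def)
  moreover have "A \<subseteq> \<Union>\<W>"
  proof
    fix a assume a: "a \<in> A"
    then obtain V where "V \<in> \<V>" "a \<in> V"
      using \<V>(2) closedin_subset[OF A] by blast
    then show "a \<in> \<Union>\<W>"
      using a by (auto simp: \<W>_def)
  qed
  moreover have "B \<subseteq> topspace X - ?C"
    using B disj by blast
  moreover have "W \<subseteq> ?C" if "W \<in> \<W>" for W
    using that closure_of_subset[OF openin_subset[OF \<V>(1)]] by (auto simp: \<W>_def)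
  then have "disjnt (\<Union>\<W>) (topspace X - ?C)"
    unfolding disjnt_def by blast
  ultimately show ?thesis by blast
qed

text \<open>The separation lemma is applied twice. With a point in the role of \<open>B\<close>, the
  Hausdorff property yields regularity; regularity is then the pointwise hypothesis for separating
  \<open>S\<close> from \<open>T\<close>.\<close>

lemma paracompact_imp_normal_space:
  assumes X: "paracompact_space X"
  shows "normal_space X"
  unfolding normal_space_def
proof (intro allI impI, elim conjE)
  fix S T assume S: "closedin X S" and T: "closedin X T" and ST: "disjnt S T"
  have H: "Hausdorff_space X"
    using X by (simp add: paracompact_space_def)
  have reg: "\<exists>U V. openin X U \<and> openin X V \<and> a \<in> U \<and> T \<subseteq> V \<and> disjnt U V" if a: "a \<in> S" for a
  proof -
    have aX: "a \<in> topspace X"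
      using a closedin_subset[OF S] by blast
    have "\<exists>U V. openin X U \<and> openin X V \<and> T \<subseteq> U \<and> {a} \<subseteq> V \<and> disjnt U V"
    proof (rule paracompact_space_separate[OF X T])
      fix b assume "b \<in> T"
      then have "b \<in> topspace X" "a \<noteq> b"
        using closedin_subset[OF T] ST a by (auto simp: disjnt_iff)
      then show "\<exists>U V. openin X U \<and> openin X V \<and> b \<in> U \<and> {a} \<subseteq> V \<and> disjnt U V"
        using H aX unfolding Hausdorff_space_def by (metis empty_subsetI insert_subset)
    qed (use aX in auto)
    then show ?thesis
      by (meson disjnt_sym insert_subset)
  qed
  show "\<exists>U V. openin X U \<and> openin X V \<and> S \<subseteq> U \<and> T \<subseteq> V \<and> disjnt U V"
    using paracompact_space_separate[OF X S closedin_subset[OF T] reg] .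
qed

section \<open>Locally finite sums and the construction of a partition of unity\<close>

text \<open>The index set of the sum varies with \<open>x\<close>, but on a neighbourhood meeting
  only finitely many members the sum equals one over a fixed finite set, since the extra terms
  vanish.\<close>

lemma locally_finite_sum_continuous_map:
  fixes f :: "'a set \<Rightarrow> 'a \<Rightarrow> real"
  assumes \<V>: "locally_finite_in X \<V>"
    and cont: "\<And>V. V \<in> \<V> \<Longrightarrow> continuous_map X euclideanreal (f V)"
    and supp: "\<And>V x. V \<in> \<V> \<Longrightarrow> x \<in> topspace X - V \<Longrightarrow> f V x = 0"
  shows "continuous_map X euclideanreal (\<lambda>x. \<Sum>V | V \<in> \<V> \<and> x \<in> V. f V x)"
  unfolding continuous_map_atin
proof
  fix a assume a: "a \<in> topspace X"
  obtain N where N: "openin X N" "a \<in> N" "finite {V \<in> \<V>. V \<inter> N \<noteq> {}}"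
    using \<V> a unfolding locally_finite_in_def by blast
  let ?A = "{V \<in> \<V>. V \<inter> N \<noteq> {}}"
  have eq: "(\<Sum>V\<in>?A. f V x) = (\<Sum>V | V \<in> \<V> \<and> x \<in> V. f V x)" if "x \<in> N" for x
    using N(3) supp that openin_subset[OF N(1)]
    by (intro sum.mono_neutral_right) auto
  have lim: "limitin euclideanreal (\<lambda>x. \<Sum>V\<in>?A. f V x) (\<Sum>V\<in>?A. f V a) (atin X a)"
    by (rule limitin_continuous_map[OF _ a]) (use cont N(3) in \<open>auto intro!: continuous_map_sum\<close>)
  have ev: "\<forall>\<^sub>F x in atin X a. (\<Sum>V\<in>?A. f V x) = (\<Sum>V | V \<in> \<V> \<and> x \<in> V. f V x)"
    using N eq unfolding eventually_atin by blast
  show "limitin euclideanreal (\<lambda>x. \<Sum>V | V \<in> \<V> \<and> x \<in> V. f V x)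
      (\<Sum>V | V \<in> \<V> \<and> a \<in> V. f V a) (atin X a)"
    using limitin_transform_eventually[OF ev lim] by (simp only: eq[OF N(2)])
qed

lemma locally_finite_in_finite_at:
  assumes "locally_finite_in X \<V>" "x \<in> topspace X"
  shows "finite {V \<in> \<V>. x \<in> V}"
proof -
  obtain N where "x \<in> N" "finite {V \<in> \<V>. V \<inter> N \<noteq> {}}"
    using assms unfolding locally_finite_in_def by blast
  then show ?thesis
    by (elim finite_subset[rotated]) blast
qed

text \<open>Normality allows the locally finite cover to be shrunk to closed sets that still cover;
  Urysohn functions for these are truncated and divided by their sum. The closure of each support,
  not only the support, is kept inside \<open>V\<close>, as the gluing of local selections
  requires.\<close>

lemma paracompact_space_partition_of_unity:
  assumes X: "paracompact_space X" and \<U>: "\<And>U. U \<in> \<U> \<Longrightarrow> openin X U" "\<Union>\<U> = topspace X"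
  obtains \<V> and \<psi> :: "'a set \<Rightarrow> 'a \<Rightarrow> real"
  where "\<And>V. V \<in> \<V> \<Longrightarrow> \<exists>U\<in>\<U>. V \<subseteq> U" "locally_finite_in X \<V>"
    "\<And>V. V \<in> \<V> \<Longrightarrow> continuous_map X euclideanreal (\<psi> V)"
    "\<And>V x. V \<in> \<V> \<Longrightarrow> x \<in> topspace X \<Longrightarrow> 0 \<le> \<psi> V x"
    "\<And>V. V \<in> \<V> \<Longrightarrow> X closure_of {x \<in> topspace X. \<psi> V x \<noteq> 0} \<subseteq> V"
    "\<And>x. x \<in> topspace X \<Longrightarrow> (\<Sum>V | V \<in> \<V> \<and> x \<in> V. \<psi> V x) = 1"
proof -
  have normal: "normal_space X"
    by (rule paracompact_imp_normal_space[OF X])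
  have T1: "closedin X {x}" if "x \<in> topspace X" for x
    using X that by (simp add: paracompact_space_def closedin_Hausdorff_singleton)
  obtain \<V> where \<V>: "\<And>V. V \<in> \<V> \<Longrightarrow> openin X V" "\<Union>\<V> = topspace X"
      "\<And>V. V \<in> \<V> \<Longrightarrow> \<exists>U\<in>\<U>. V \<subseteq> U" "locally_finite_in X \<V>"
    using paracompact_space_refinement[OF X \<U>] by blast
  define \<W>0 where "\<W>0 = {W. openin X W \<and> (\<exists>V\<in>\<V>. X closure_of W \<subseteq> V)}"
  have "topspace X \<subseteq> \<Union>\<W>0"
  proof
    fix x assume x: "x \<in> topspace X"
    then obtain V where V: "V \<in> \<V>" "x \<in> V"
      using \<V>(2) by blast
    then have "\<exists>W. openin X W \<and> {x} \<subseteq> W \<and> X closure_of W \<subseteq> V"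
      using normal T1[OF x] \<V>(1)[OF V(1)] unfolding normal_space_alt by blast
    then show "x \<in> \<Union>\<W>0"
      using V(1) unfolding \<W>0_def by blast
  qed
  moreover have "\<Union>\<W>0 \<subseteq> topspace X"
    unfolding \<W>0_def by (auto dest: openin_subset)
  ultimately have "\<Union>\<W>0 = topspace X" by blast
  moreover have "\<And>W. W \<in> \<W>0 \<Longrightarrow> openin X W"
    by (auto simp: \<W>0_def)
  ultimately obtain \<W> where \<W>: "\<And>W. W \<in> \<W> \<Longrightarrow> openin X W" "\<Union>\<W> = topspace X"
      "\<And>W. W \<in> \<W> \<Longrightarrow> \<exists>U\<in>\<W>0. W \<subseteq> U" "locally_finite_in X \<W>"
    using paracompact_space_refinement[OF X] by (metis (lifting))
  \<comment> \<open>The closed shrinking of \<open>V\<close>: a union of closures from a locally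
    finite family is closed, and every \<open>W\<close> has its closure inside some
    \<open>V\<close>, so the sets \<open>F V\<close> cover.\<close>
  define F where "F V = (\<Union>W\<in>{W\<in>\<W>. X closure_of W \<subseteq> V}. X closure_of W)" for V
  have F_closed: "closedin X (F V)" for V
    unfolding F_def
    by (intro closedin_Union_locally_finite_closure locally_finite_in_subset[OF \<W>(4)]) auto
  have F_sub: "F V \<subseteq> V" for V
    by (auto simp: F_def)
  have F_cover: "\<exists>V\<in>\<V>. x \<in> F V" if x: "x \<in> topspace X" for x
  proof -
    obtain W where W: "W \<in> \<W>" "x \<in> W"
      using x \<W>(2) by blast
    then obtain U V where "W \<subseteq> U" "V \<in> \<V>" "X closure_of U \<subseteq> V"
      using \<W>(3) unfolding \<W>0_def by blast
    then have "X closure_of W \<subseteq> V"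
      by (meson closure_of_mono order_trans)
    moreover have "x \<in> X closure_of W"
      using closure_of_subset[OF openin_subset[OF \<W>(1)[OF W(1)]]] W(2) by blast
    ultimately show ?thesis
      using W \<open>V \<in> \<V>\<close> unfolding F_def by blast
  qed
  have "\<exists>h. continuous_map X euclideanreal h \<and> h ` F V \<subseteq> {1} \<and> h ` (topspace X - V) \<subseteq> {0}"
    if V: "V \<in> \<V>" for V
  proof -
    have "closedin X (topspace X - V)" "disjnt (F V) (topspace X - V)"
      using \<V>(1)[OF V] F_sub[of V] by (auto simp: disjnt_iff)
    with Urysohn_lemma_alt[OF normal F_closed] show ?thesis
      by metis
  qed
  then obtain h where h: "\<And>V. V \<in> \<V> \<Longrightarrow> continuous_map X euclideanreal (h V)"
      "\<And>V. V \<in> \<V> \<Longrightarrow> h V ` F V \<subseteq> {1}" "\<And>V. V \<in> \<V> \<Longrightarrow> h V ` (topspace X - V) \<subseteq> {0 :: real}"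
    by metis
  \<comment> \<open>Cutting off at 1/2 confines the closure of the support to the closed set where
    \<open>h V\<close> is at least 1/2, which lies in \<open>V\<close>; on \<open>F V\<close> the
    value is still 1/2.\<close>
  define k where "k V x = max 0 (h V x - 1/2)" for V x
  define \<sigma> where "\<sigma> x = (\<Sum>V | V \<in> \<V> \<and> x \<in> V. k V x)" for x
  have k_cont: "continuous_map X euclideanreal (k V)" if "V \<in> \<V>" for V
    unfolding k_def using h(1)[OF that] by (intro continuous_intros) auto
  have k_zero: "k V x = 0" if "V \<in> \<V>" "x \<in> topspace X - V" for V x
    using h(3)[OF that(1)] that(2) by (auto simp: k_def image_subset_iff)
  have k_nonneg: "0 \<le> k V x" for V x
    by (simp add: k_def)
  have \<sigma>_cont: "continuous_map X euclideanreal \<sigma>"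
    unfolding \<sigma>_def by (rule locally_finite_sum_continuous_map[OF \<V>(4) k_cont k_zero])
  have \<sigma>_pos: "0 < \<sigma> x" if x: "x \<in> topspace X" for x
  proof -
    obtain V where V: "V \<in> \<V>" "x \<in> F V"
      using F_cover[OF x] by blast
    then have "k V x > 0"
      using h(2) by (fastforce simp: k_def)
    then show ?thesis
      unfolding \<sigma>_def
      by (intro sum_pos2[where i = V])
        (use V F_sub k_nonneg locally_finite_in_finite_at[OF \<V>(4) x] in auto)
  qed
  show thesis
  proof (rule that[of \<V> "\<lambda>V x. k V x / \<sigma> x"])
    fix V assume V: "V \<in> \<V>"
    show "continuous_map X euclideanreal (\<lambda>x. k V x / \<sigma> x)"
      using \<sigma>_pos by (intro continuous_map_real_divide k_cont[OF V] \<sigma>_cont) force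
    show "0 \<le> k V x / \<sigma> x" if "x \<in> topspace X" for x
      using k_nonneg \<sigma>_pos[OF that] by simp
    let ?H = "{x \<in> topspace X. h V x \<in> {1/2..}}"
    have "closedin X ?H"
      by (rule closedin_continuous_map_preimage[OF h(1)[OF V]]) simp
    then have "X closure_of {x \<in> topspace X. k V x / \<sigma> x \<noteq> 0} \<subseteq> ?H"
      by (intro closure_of_minimal) (auto simp: k_def max_def split: if_splits)
    moreover have "?H \<subseteq> V"
      using h(3)[OF V] by force
    ultimately show "X closure_of {x \<in> topspace X. k V x / \<sigma> x \<noteq> 0} \<subseteq> V"
      by blast
  next
    fix x assume "x \<in> topspace X"
    then show "(\<Sum>V | V \<in> \<V> \<and> x \<in> V. k V x / \<sigma> x) = 1"
      using \<sigma>_pos[of x] by (simp add: \<sigma>_def flip: sum_divide_distrib)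
  qed (use \<V> in auto)
qed

section \<open>Linear combinations and distances in Banach spaces\<close>

context banach_space_on
begin

definition vdist :: "'e \<Rightarrow> 'e \<Rightarrow> real" where
  "vdist x y = nrm (add x (smul (- 1) y))"

text \<open>A fiber is a set with explicit operations, so its finite sums are taken as products in
  the commutative monoid it carries. The coefficients are real because they will be the values of a
  partition of unity.\<close>

definition lincomb :: "('i \<Rightarrow> real) \<Rightarrow> ('i \<Rightarrow> 'e) \<Rightarrow> 'i set \<Rightarrow> 'e" where
  "lincomb c x A =
     finprod \<lparr>carrier = V, mult = add, one = orig\<rparr> (\<lambda>i. smul (of_real (c i)) (x i)) A"

lemma vec_comm_monoid: "comm_monoid \<lparr>carrier = V, mult = add, one = orig\<rparr>"
proof (rule comm_monoidI)
  fix x assume "x \<in> carrier \<lparr>carrier = V, mult = add, one = orig\<rparr>"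
  then show "\<one>\<^bsub>\<lparr>carrier = V, mult = add, one = orig\<rparr>\<^esub> \<otimes>\<^bsub>\<lparr>carrier = V, mult = add, one = orig\<rparr>\<^esub> x = x"
    using add_comm[of orig x] add_orig[of x] orig_closed by simp
qed (simp_all add: orig_closed add_closed add_assoc, rule add_comm)

section \<open>The norm distance in a Banach space\<close>

lemma add_left_comm: "\<lbrakk>x \<in> V; y \<in> V; z \<in> V\<rbrakk> \<Longrightarrow> add x (add y z) = add y (add x z)"
  using add_assoc add_comm by metis

lemmas closed = orig_closed add_closed smul_closed
lemmas add_ac = add_assoc add_comm add_left_comm

lemma orig_add: "x \<in> V \<Longrightarrow> add orig x = x"
  using add_comm add_orig orig_closed by metis

lemma nrm_orig: "nrm orig = 0"
  using nrm_eq_0 orig_closed by blast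

lemma smul_zero: "x \<in> V \<Longrightarrow> smul 0 x = orig"
  using nrm_eq_0[of "smul 0 x"] by (simp add: smul_closed nrm_smul)

lemma smul_orig: "smul c orig = orig"
  using nrm_eq_0[of "smul c orig"] by (simp add: closed nrm_smul nrm_orig)

lemma add_minus: "x \<in> V \<Longrightarrow> add x (smul (- 1) x) = orig"
  using smul_add_left[of x 1 "- 1"] by (simp add: smul_one smul_zero)

lemma minus_add_cancel: "\<lbrakk>x \<in> V; y \<in> V\<rbrakk> \<Longrightarrow> add y (add x (smul (- 1) y)) = x"
  using add_left_comm[of y x "smul (- 1) y"] by (simp add: add_minus add_orig smul_closed)

lemma vdist_nonneg: "\<lbrakk>x \<in> V; y \<in> V\<rbrakk> \<Longrightarrow> 0 \<le> vdist x y"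
  by (simp add: vdist_def nrm_nonneg closed)

lemma vdist_self: "x \<in> V \<Longrightarrow> vdist x x = 0"
  by (simp add: vdist_def add_minus nrm_orig)

lemma vdist_eq_0:
  assumes xy: "x \<in> V" "y \<in> V"
  shows "vdist x y = 0 \<longleftrightarrow> x = y"
proof
  assume "vdist x y = 0"
  then have "add x (smul (- 1) y) = orig"
    using nrm_eq_0[of "add x (smul (- 1) y)"] xy by (simp add: vdist_def closed)
  then show "x = y"
    using minus_add_cancel[OF xy] xy by (simp add: add_orig)
qed (use xy in \<open>simp add: vdist_self\<close>)

lemma vdist_commute:
  assumes "x \<in> V" "y \<in> V"
  shows "vdist x y = vdist y x"
proof -
  have "smul (- 1) (add x (smul (- 1) y)) = add y (smul (- 1) x)"
    using assms by (simp add: smul_add_right smul_smul smul_one closed add_comm)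
  then show ?thesis
    using nrm_smul[of "add x (smul (- 1) y)" "- 1"] assms by (simp add: vdist_def closed)
qed

lemma vdist_triangle:
  assumes "x \<in> V" "y \<in> V" "z \<in> V"
  shows "vdist x z \<le> vdist x y + vdist y z"
proof -
  have "add (add x (smul (- 1) y)) (add y (smul (- 1) z))
      = add x (add (add y (smul (- 1) y)) (smul (- 1) z))"
    using assms by (simp add: closed add_ac)
  also have "\<dots> = add x (smul (- 1) z)"
    using assms by (simp add: add_minus closed orig_add)
  finally show ?thesis
    using nrm_triangle[of "add x (smul (- 1) y)" "add y (smul (- 1) z)"] assms
    by (simp add: vdist_def closed)
qed

lemma vdist_add:
  assumes "x \<in> V" "y \<in> V" "x' \<in> V" "y' \<in> V"
  shows "vdist (add x y) (add x' y') \<le> vdist x x' + vdist y y'"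
proof -
  have "add (add x y) (smul (- 1) (add x' y'))
      = add (add x (smul (- 1) x')) (add y (smul (- 1) y'))"
    using assms by (simp add: closed smul_add_right add_ac)
  then show ?thesis
    using nrm_triangle[of "add x (smul (- 1) x')" "add y (smul (- 1) y')"] assms
    by (simp add: vdist_def closed)
qed

lemma vdist_smul:
  assumes "x \<in> V" "y \<in> V"
  shows "vdist (smul c x) (smul c y) = norm c * vdist x y"
proof -
  have "add (smul c x) (smul (- 1) (smul c y)) = smul c (add x (smul (- 1) y))"
    using assms by (simp add: closed smul_add_right smul_smul)
  then show ?thesis
    using assms by (simp add: vdist_def nrm_smul closed)
qed

section \<open>Finite linear combinations\<close>

lemma lincomb_empty [simp]: "lincomb c x {} = orig"
proof -
  interpret M: comm_monoid "\<lparr>carrier = V, mult = add, one = orig\<rparr>"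
    by (rule vec_comm_monoid)
  show ?thesis
    using M.finprod_empty by (simp add: lincomb_def)
qed

lemma lincomb_closed:
  assumes "\<And>i. i \<in> A \<Longrightarrow> x i \<in> V"
  shows "lincomb c x A \<in> V"
proof -
  interpret M: comm_monoid "\<lparr>carrier = V, mult = add, one = orig\<rparr>"
    by (rule vec_comm_monoid)
  show ?thesis
    using M.finprod_closed[of "\<lambda>i. smul (of_real (c i)) (x i)" A] assms
    by (simp add: lincomb_def closed Pi_iff)
qed

lemma lincomb_insert:
  assumes "finite A" "a \<notin> A" "\<And>i. i \<in> insert a A \<Longrightarrow> x i \<in> V"
  shows "lincomb c x (insert a A) = add (smul (of_real (c a)) (x a)) (lincomb c x A)"
proof -
  interpret M: comm_monoid "\<lparr>carrier = V, mult = add, one = orig\<rparr>"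
    by (rule vec_comm_monoid)
  show ?thesis
    using M.finprod_insert[of A a "\<lambda>i. smul (of_real (c i)) (x i)"] assms
    by (simp add: lincomb_def closed Pi_iff)
qed

text \<open>Used in gluing to pass between index sets that differ only by vanishing
  coefficients.\<close>

lemma lincomb_mono_neutral:
  assumes "finite B" "A \<subseteq> B" "\<And>i. i \<in> B - A \<Longrightarrow> c i = 0" "\<And>i. i \<in> B \<Longrightarrow> x i \<in> V"
  shows "lincomb c x A = lincomb c x B"
proof -
  interpret M: comm_monoid "\<lparr>carrier = V, mult = add, one = orig\<rparr>"
    by (rule vec_comm_monoid)
  show ?thesis
    unfolding lincomb_def using assms
    by (intro M.finprod_mono_neutral_cong_left) (auto simp: smul_zero closed)
qed

lemma lincomb_cong:
  assumes "\<And>i. i \<in> A \<Longrightarrow> x i = y i" "\<And>i. i \<in> A \<Longrightarrow> y i \<in> V"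
  shows "lincomb c x A = lincomb c y A"
proof -
  interpret M: comm_monoid "\<lparr>carrier = V, mult = add, one = orig\<rparr>"
    by (rule vec_comm_monoid)
  show ?thesis
    unfolding lincomb_def using assms
    by (intro M.finprod_cong') (auto simp: closed)
qed

lemma lincomb_const:
  assumes "finite A" "a \<in> V"
  shows "lincomb c (\<lambda>_. a) A = smul (of_real (sum c A)) a"
  using assms(1)
proof induction
  case (insert i A)
  then show ?case
    using assms(2) by (simp add: lincomb_insert smul_add_left)
qed (simp add: smul_zero assms)

lemma vdist_lincomb:
  assumes "finite A" "\<And>i. i \<in> A \<Longrightarrow> x i \<in> V" "\<And>i. i \<in> A \<Longrightarrow> y i \<in> V"
  shows "vdist (lincomb c x A) (lincomb c y A) \<le> (\<Sum>i\<in>A. \<bar>c i\<bar> * vdist (x i) (y i))"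
  using assms
proof induction
  case (insert i A)
  have "vdist (lincomb c x (insert i A)) (lincomb c y (insert i A))
      \<le> vdist (smul (of_real (c i)) (x i)) (smul (of_real (c i)) (y i))
        + vdist (lincomb c x A) (lincomb c y A)"
    using insert.hyps insert.prems
    by (simp add: lincomb_insert del: insert_iff) (intro vdist_add closed lincomb_closed; simp)
  also have "\<dots> \<le> \<bar>c i\<bar> * vdist (x i) (y i) + (\<Sum>i\<in>A. \<bar>c i\<bar> * vdist (x i) (y i))"
    using insert by (simp add: vdist_smul)
  finally show ?case
    using insert.hyps by simp
qed (simp add: vdist_self closed)

text \<open>Convexity of closed balls: the center \<open>a\<close> is the same convex combination of
  the constant family \<open>a\<close>, so the termwise estimate applies.\<close>

lemma vdist_convex_comb_le:
  assumes A: "finite A" "\<And>i. i \<in> A \<Longrightarrow> x i \<in> V" "a \<in> V"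
    and c: "\<And>i. i \<in> A \<Longrightarrow> 0 \<le> c i" "sum c A = 1"
    and r: "\<And>i. i \<in> A \<Longrightarrow> vdist a (x i) \<le> r"
  shows "vdist a (lincomb c x A) \<le> r"
proof -
  have "vdist a (lincomb c x A) = vdist (lincomb c (\<lambda>_. a) A) (lincomb c x A)"
    using A c by (simp add: lincomb_const smul_one)
  also have "\<dots> \<le> (\<Sum>i\<in>A. \<bar>c i\<bar> * vdist a (x i))"
    using A by (intro vdist_lincomb) auto
  also have "\<dots> \<le> (\<Sum>i\<in>A. c i * r)"
    using c r by (intro sum_mono) (auto intro!: mult_left_mono)
  also have "\<dots> = r"
    using c by (simp flip: sum_distrib_right)
  finally show ?thesis .
qed

lemma complete_vdist:
  assumes "\<And>n. \<sigma> n \<in> V" and "\<And>e. 0 < e \<Longrightarrow> \<exists>N. \<forall>m\<ge>N. \<forall>n\<ge>N. vdist (\<sigma> m) (\<sigma> n) < e"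
  obtains l where "l \<in> V" "(\<lambda>n. vdist (\<sigma> n) l) \<longlonglongrightarrow> 0"
  using complete[of \<sigma>] assms unfolding vdist_def by blast

end

section \<open>Approximately continuous selections\<close>

context banach_bundle
begin

abbreviation E :: "'e topology" where "E \<equiv> tot_space \<xi>"
abbreviation T :: "'t topology" where "T \<equiv> base_space \<xi>"

abbreviation bdist :: "'e \<Rightarrow> 'e \<Rightarrow> real" where
  "bdist \<equiv> banach_space_on.vdist (badd \<xi>) (bsmul \<xi>) (bnorm \<xi>)"

abbreviation blincomb :: "'t \<Rightarrow> ('i \<Rightarrow> real) \<Rightarrow> ('i \<Rightarrow> 'e) \<Rightarrow> 'i set \<Rightarrow> 'e" where
  "blincomb t \<equiv> banach_space_on.lincomb (fiber \<xi> t) (badd \<xi>) (bsmul \<xi>) (borig \<xi> t)"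

text \<open>
  The error is measured inside the fibers, since points of different fibers have no distance.
\<close>

definition approx_cont :: "('t \<Rightarrow> real) \<Rightarrow> ('t \<Rightarrow> 'e) \<Rightarrow> 't \<Rightarrow> bool" where
  "approx_cont e f a \<longleftrightarrow> (\<forall>W. openin E W \<longrightarrow> f a \<in> W \<longrightarrow>
     (\<forall>\<^sub>F t in nhdsin T a. \<exists>w\<in>W. proj \<xi> w = t \<and> bdist (f t) w \<le> e t))"

section \<open>Neighbourhood forms of the bundle axioms\<close>

lemma fiberD: "x \<in> fiber \<xi> t \<Longrightarrow> x \<in> topspace E" "x \<in> fiber \<xi> t \<Longrightarrow> proj \<xi> x = t"
  by (auto simp: fiber_def)

lemma fiberI: "x \<in> topspace E \<Longrightarrow> proj \<xi> x = t \<Longrightarrow> x \<in> fiber \<xi> t"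
  by (auto simp: fiber_def)

lemma same_proj: "x \<in> fiber \<xi> t \<Longrightarrow> y \<in> fiber \<xi> t \<Longrightarrow> proj \<xi> x = proj \<xi> y"
  by (simp add: fiber_def)

lemma proj_in_base: "x \<in> topspace E \<Longrightarrow> proj \<xi> x \<in> topspace T"
  using proj_surj by blast

lemma eventually_base: "\<forall>\<^sub>F t in nhdsin T a. t \<in> topspace T"
  by (auto simp: eventually_nhdsin)

lemma eventually_nhdsin_open: "openin T N \<Longrightarrow> a \<in> N \<Longrightarrow> \<forall>\<^sub>F t in nhdsin T a. t \<in> N"
  by (auto simp: eventually_nhdsin)

text \<open>Openness of the projection: an open set meeting the fiber over \<open>a\<close> meets
  all nearby fibers. This stands in for local sections through a given point.\<close>

lemma eventually_proj_image:
  assumes "openin E W" "x \<in> W" "proj \<xi> x = a"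
  shows "\<forall>\<^sub>F t in nhdsin T a. \<exists>w\<in>W. proj \<xi> w = t"
proof -
  have "openin T (proj \<xi> ` W)"
    using proj_open assms(1) by (simp add: open_map_def)
  then have "\<forall>\<^sub>F t in nhdsin T a. t \<in> proj \<xi> ` W"
    using assms by (intro eventually_nhdsin_open) auto
  then show ?thesis
    by (rule eventually_mono) blast
qed

text \<open>An open set of the fibered product is the trace of an open set of the full product,
  which contains a rectangle around \<open>(x, y)\<close>.\<close>

lemma add_nbhd:
  assumes "openin E W" "badd \<xi> x y \<in> W" "x \<in> topspace E" "y \<in> topspace E" "proj \<xi> x = proj \<xi> y"
  obtains X Y where "openin E X" "openin E Y" "x \<in> X" "y \<in> Y"
    "\<And>u v. u \<in> X \<Longrightarrow> v \<in> Y \<Longrightarrow> proj \<xi> u = proj \<xi> v \<Longrightarrow> badd \<xi> u v \<in> W"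
proof -
  let ?D = "{(x, y). proj \<xi> x = proj \<xi> y}"
  let ?P = "subtopology (prod_topology E E) ?D"
  have "openin ?P {z \<in> topspace ?P. (case z of (x, y) \<Rightarrow> badd \<xi> x y) \<in> W}"
    using add_continuous assms(1) by (rule openin_continuous_map_preimage)
  then obtain Q where Q: "openin (prod_topology E E) Q"
      "{z \<in> topspace ?P. (case z of (x, y) \<Rightarrow> badd \<xi> x y) \<in> W} = Q \<inter> ?D"
    unfolding openin_subtopology by blast
  have "(x, y) \<in> {z \<in> topspace ?P. (case z of (x, y) \<Rightarrow> badd \<xi> x y) \<in> W}"
    using assms by simp
  then have "(x, y) \<in> Q"
    using Q(2) by blast
  then obtain X Y where XY: "openin E X" "openin E Y" "x \<in> X" "y \<in> Y" "X \<times> Y \<subseteq> Q"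
    using Q(1) unfolding openin_prod_topology_alt by meson
  show thesis
  proof (rule that[OF XY(1-4)])
    fix u v assume "u \<in> X" "v \<in> Y" "proj \<xi> u = proj \<xi> v"
    then have "(u, v) \<in> Q \<inter> ?D"
      using XY(5) by blast
    then have "(u, v) \<in> {z \<in> topspace ?P. (case z of (x, y) \<Rightarrow> badd \<xi> x y) \<in> W}"
      by (simp only: Q(2))
    then show "badd \<xi> u v \<in> W" by simp
  qed
qed

lemma smul_nbhd:
  assumes "openin E W" "bsmul \<xi> c x \<in> W" "x \<in> topspace E"
  obtains C X where "open C" "openin E X" "c \<in> C" "x \<in> X"
    "\<And>d u. d \<in> C \<Longrightarrow> u \<in> X \<Longrightarrow> bsmul \<xi> d u \<in> W"
proof -
  let ?P = "prod_topology euclidean E"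
  let ?Q = "{z \<in> topspace ?P. (case z of (c, x) \<Rightarrow> bsmul \<xi> c x) \<in> W}"
  have Q: "openin ?P ?Q"
    using smul_continuous assms(1) by (rule openin_continuous_map_preimage)
  have "(c, x) \<in> ?Q"
    using assms by simp
  then obtain C X where CX: "openin euclidean C" "openin E X" "c \<in> C" "x \<in> X" "C \<times> X \<subseteq> ?Q"
    using Q unfolding openin_prod_topology_alt by meson
  show thesis
  proof (rule that[OF _ CX(2-4)])
    show "open C"
      using CX(1) by simp
    fix d u assume "d \<in> C" "u \<in> X"
    then have "(d, u) \<in> ?Q"
      using CX(5) by blast
    then show "bsmul \<xi> d u \<in> W" by simp
  qed
qed

text \<open>Upper semicontinuity makes a strict upper bound on the norm an open condition; it is
  pulled back along the difference, which is continuous by the continuity of addition and of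
  multiplication by -1.\<close>

lemma dist_nbhd:
  assumes "x \<in> topspace E" "y \<in> topspace E" "proj \<xi> x = proj \<xi> y" "bdist x y < r"
  obtains X Y where "openin E X" "openin E Y" "x \<in> X" "y \<in> Y"
    "\<And>u v. u \<in> X \<Longrightarrow> v \<in> Y \<Longrightarrow> proj \<xi> u = proj \<xi> v \<Longrightarrow> bdist u v < r"
proof -
  interpret V: banach_space_on "fiber \<xi> (proj \<xi> x)" "badd \<xi>" "bsmul \<xi>" "borig \<xi> (proj \<xi> x)" "bnorm \<xi>"
    by (rule fiber_banach[OF proj_in_base[OF assms(1)]])
  let ?W = "{z \<in> topspace E. bnorm \<xi> z < r}"
  have y: "bsmul \<xi> (- 1) y \<in> fiber \<xi> (proj \<xi> x)"
    using assms by (intro V.smul_closed) (auto simp: fiber_def)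
  have "badd \<xi> x (bsmul \<xi> (- 1) y) \<in> ?W"
    using assms V.add_closed[OF _ y, of x] by (simp add: V.vdist_def fiber_def)
  then obtain X Y where XY: "openin E X" "openin E Y" "x \<in> X" "bsmul \<xi> (- 1) y \<in> Y"
    "\<And>u v. u \<in> X \<Longrightarrow> v \<in> Y \<Longrightarrow> proj \<xi> u = proj \<xi> v \<Longrightarrow> badd \<xi> u v \<in> ?W"
    using y assms(1) by (elim add_nbhd[OF norm_upper_semicontinuous]) (auto simp: fiber_def)
  obtain C Y' where Y': "openin E Y'" "y \<in> Y'" "- 1 \<in> C"
    "\<And>d u. d \<in> C \<Longrightarrow> u \<in> Y' \<Longrightarrow> bsmul \<xi> d u \<in> Y"
    using smul_nbhd[OF XY(2,4) assms(2)] by metis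
  show thesis
  proof (rule that[OF XY(1) Y'(1) XY(3) Y'(2)])
    fix u v assume uv: "u \<in> X" "v \<in> Y'" "proj \<xi> u = proj \<xi> v"
    have vE: "v \<in> topspace E"
      using Y'(1) uv(2) openin_subset by blast
    interpret V': banach_space_on "fiber \<xi> (proj \<xi> v)" "badd \<xi>" "bsmul \<xi>" "borig \<xi> (proj \<xi> v)" "bnorm \<xi>"
      by (rule fiber_banach[OF proj_in_base[OF vE]])
    have "proj \<xi> (bsmul \<xi> (- 1) v) = proj \<xi> v"
      using V'.smul_closed[of v "- 1"] vE by (simp add: fiber_def)
    then show "bdist u v < r"
      using XY(5)[OF uv(1) Y'(4)[OF Y'(3) uv(2)]] uv(3) by (simp add: V.vdist_def)
  qed
qed

text \<open>The distance of \<open>x\<close> to itself is 0, so the previous lemma applies to the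
  pair \<open>(x, x)\<close>; the two neighbourhoods are intersected.\<close>

lemma thin_nbhd:
  assumes "x \<in> topspace E" "0 < r"
  obtains U where "openin E U" "x \<in> U"
    "\<And>u v. u \<in> U \<Longrightarrow> v \<in> U \<Longrightarrow> proj \<xi> u = proj \<xi> v \<Longrightarrow> bdist u v < r"
proof -
  interpret V: banach_space_on "fiber \<xi> (proj \<xi> x)" "badd \<xi>" "bsmul \<xi>" "borig \<xi> (proj \<xi> x)" "bnorm \<xi>"
    by (rule fiber_banach[OF proj_in_base[OF assms(1)]])
  have "bdist x x < r"
    using assms by (simp add: V.vdist_self fiberI)
  then obtain X Y where XY: "openin E X" "openin E Y" "x \<in> X" "x \<in> Y"
    "\<And>u v. u \<in> X \<Longrightarrow> v \<in> Y \<Longrightarrow> proj \<xi> u = proj \<xi> v \<Longrightarrow> bdist u v < r"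
    using dist_nbhd[OF assms(1) assms(1) refl] by metis
  show thesis
    by (rule that[of "X \<inter> Y"]) (use XY in auto)
qed

text \<open>The net axiom is applied to the coarsest filter on the bundle space along which the
  projection tends to \<open>a\<close> and the norm to 0. That \<open>W\<close> belongs to this
  filter unpacks into a neighbourhood of \<open>a\<close> and a bound \<open>d\<close> on the
  norm.\<close>

lemma zero_nbhd:
  assumes W: "openin E W" "borig \<xi> a \<in> W" and a: "a \<in> topspace T"
  obtains d where "0 < d"
    "\<forall>\<^sub>F t in nhdsin T a. \<forall>x\<in>fiber \<xi> t. bnorm \<xi> x < d \<longrightarrow> x \<in> W"
proof -
  let ?F = "inf (principal (topspace E)) (inf (filtercomap (proj \<xi>) (nhdsin T a)) (filtercomap (bnorm \<xi>) (nhds 0)))"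
  have "limitin E (\<lambda>x. x) (borig \<xi> a) ?F"
  proof (rule norm_net[OF a])
    show "\<forall>\<^sub>F x in ?F. x \<in> topspace E"
      by (rule filter_leD[OF inf_le1]) (simp add: eventually_principal)
    show "limitin T (proj \<xi>) a ?F"
      unfolding limitin_def
    proof (intro conjI allI impI a; elim conjE)
      fix U assume "openin T U" "a \<in> U"
      then have "\<forall>\<^sub>F x in filtercomap (proj \<xi>) (nhdsin T a). proj \<xi> x \<in> U"
        by (intro eventually_filtercomapI eventually_nhdsin_open)
      then show "\<forall>\<^sub>F x in ?F. proj \<xi> x \<in> U"
        by (rule filter_leD[rotated]) (auto intro: le_infI2 le_infI1)
    qed
    show "(bnorm \<xi> \<longlongrightarrow> 0) ?F"
      by (rule filterlim_mono[OF filterlim_filtercomap order_refl]) (auto intro: le_infI2)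
  qed
  then have "\<forall>\<^sub>F x in ?F. x \<in> W"
    using W by (auto simp: limitin_def)
  then obtain P Q R where PQR: "\<forall>\<^sub>F t in nhdsin T a. Q t" "\<forall>\<^sub>F r in nhds (0::real). R r"
    "\<And>x. x \<in> topspace E \<Longrightarrow> Q (proj \<xi> x) \<Longrightarrow> R (bnorm \<xi> x) \<Longrightarrow> x \<in> W"
    unfolding eventually_inf eventually_principal eventually_filtercomap by metis
  from PQR(2) obtain d where d: "0 < d" "\<And>r. \<bar>r\<bar> < d \<Longrightarrow> R r"
    unfolding eventually_nhds_metric by (auto simp: dist_real_def)
  show thesis
  proof (rule that[OF d(1)])
    show "\<forall>\<^sub>F t in nhdsin T a. \<forall>x\<in>fiber \<xi> t. bnorm \<xi> x < d \<longrightarrow> x \<in> W"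
      using PQR(1) eventually_base
    proof eventually_elim
      case (elim t)
      show ?case
      proof (intro ballI impI)
        fix x assume x: "x \<in> fiber \<xi> t" "bnorm \<xi> x < d"
        then have "0 \<le> bnorm \<xi> x"
          using banach_space_on.nrm_nonneg[OF fiber_banach[OF elim(2)]] by blast
        then show "x \<in> W"
          using x d(2) PQR(3)[of x] elim(1) by (simp add: fiber_def)
      qed
    qed
  qed
qed

section \<open>Calculus of approximately continuous selections\<close>

lemma approx_contD:
  "approx_cont e f a \<Longrightarrow> openin E W \<Longrightarrow> f a \<in> W \<Longrightarrow>
     \<forall>\<^sub>F t in nhdsin T a. \<exists>w\<in>W. proj \<xi> w = t \<and> bdist (f t) w \<le> e t"
  by (simp add: approx_cont_def)

lemma approx_cont_cong:
  assumes f: "approx_cont e f a" and fg: "\<forall>\<^sub>F t in nhdsin T a. f t = g t"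
    and ed: "\<forall>\<^sub>F t in nhdsin T a. e t \<le> d t" and a: "a \<in> topspace T"
  shows "approx_cont d g a"
  unfolding approx_cont_def
proof (intro allI impI)
  fix W assume W: "openin E W" "g a \<in> W"
  \<comment> \<open>The filter \<open>nhdsin\<close> does not exclude the point itself, so eventual
    equality includes equality at \<open>a\<close>.\<close>
  have "f a = g a"
    using fg a by (auto simp: eventually_nhdsin)
  then have "\<forall>\<^sub>F t in nhdsin T a. \<exists>w\<in>W. proj \<xi> w = t \<and> bdist (f t) w \<le> e t"
    using approx_contD[OF f W(1)] W(2) by simp
  then show "\<forall>\<^sub>F t in nhdsin T a. \<exists>w\<in>W. proj \<xi> w = t \<and> bdist (g t) w \<le> d t"
    using fg ed by eventually_elim force
qed

lemma approx_cont_borig: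
  assumes a: "a \<in> topspace T"
  shows "approx_cont (\<lambda>_. 0) (borig \<xi>) a"
  unfolding approx_cont_def
proof (intro allI impI)
  fix W assume W: "openin E W" "borig \<xi> a \<in> W"
  obtain d where d: "0 < d"
      "\<forall>\<^sub>F t in nhdsin T a. \<forall>x\<in>fiber \<xi> t. bnorm \<xi> x < d \<longrightarrow> x \<in> W"
    by (rule zero_nbhd[OF W a])
  show "\<forall>\<^sub>F t in nhdsin T a. \<exists>w\<in>W. proj \<xi> w = t \<and> bdist (borig \<xi> t) w \<le> 0"
    using d(2) eventually_base
  proof eventually_elim
    case (elim t)
    interpret V: banach_space_on "fiber \<xi> t" "badd \<xi>" "bsmul \<xi>" "borig \<xi> t" "bnorm \<xi>"
      by (rule fiber_banach[OF elim(2)])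
    show ?case
      using elim(1) d(1) V.orig_closed V.nrm_orig V.vdist_self[OF V.orig_closed]
      by (intro bexI[of _ "borig \<xi> t"]) (auto simp: fiber_def)
  qed
qed

lemma approx_cont_add:
  assumes f: "approx_cont e f a" and g: "approx_cont d g a"
    and sel: "\<And>t. t \<in> topspace T \<Longrightarrow> f t \<in> fiber \<xi> t" "\<And>t. t \<in> topspace T \<Longrightarrow> g t \<in> fiber \<xi> t"
    and a: "a \<in> topspace T"
  shows "approx_cont (\<lambda>t. e t + d t) (\<lambda>t. badd \<xi> (f t) (g t)) a"
  unfolding approx_cont_def
proof (intro allI impI)
  fix W assume W: "openin E W" "badd \<xi> (f a) (g a) \<in> W"
  obtain X Y where XY: "openin E X" "openin E Y" "f a \<in> X" "g a \<in> Y"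
    "\<And>u v. u \<in> X \<Longrightarrow> v \<in> Y \<Longrightarrow> proj \<xi> u = proj \<xi> v \<Longrightarrow> badd \<xi> u v \<in> W"
    by (rule add_nbhd[OF W sel[OF a, THEN fiberD(1)] same_proj[OF sel[OF a]]]) blast
  show "\<forall>\<^sub>F t in nhdsin T a. \<exists>w\<in>W. proj \<xi> w = t \<and> bdist (badd \<xi> (f t) (g t)) w \<le> e t + d t"
    using approx_contD[OF f XY(1,3)] approx_contD[OF g XY(2,4)] eventually_base
  proof eventually_elim
    case (elim t)
    then obtain u v where uv: "u \<in> X" "proj \<xi> u = t" "bdist (f t) u \<le> e t"
      "v \<in> Y" "proj \<xi> v = t" "bdist (g t) v \<le> d t"
      by blast
    interpret V: banach_space_on "fiber \<xi> t" "badd \<xi>" "bsmul \<xi>" "borig \<xi> t" "bnorm \<xi>"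
      by (rule fiber_banach[OF elim(3)])
    have uvt: "u \<in> fiber \<xi> t" "v \<in> fiber \<xi> t"
      using uv openin_subset[OF XY(1)] openin_subset[OF XY(2)] by (auto simp: fiber_def)
    have "bdist (badd \<xi> (f t) (g t)) (badd \<xi> u v) \<le> e t + d t"
      using V.vdist_add[of "f t" "g t" u v] uvt sel[OF elim(3)] uv by simp
    moreover have "proj \<xi> (badd \<xi> u v) = t"
      using V.add_closed[OF uvt] by (simp add: fiber_def)
    ultimately show ?case
      using XY(5)[OF uv(1,4)] uv(2,5) by (intro bexI[of _ "badd \<xi> u v"]) auto
  qed
qed

text \<open>Scaling multiplies the error by \<open>\<bar>c t\<bar>\<close>, which varies with
  \<open>t\<close>; for this reason errors are functions of the base point.\<close>

lemma approx_cont_smul: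
  fixes c :: "'t \<Rightarrow> real"
  assumes f: "approx_cont e f a" and c: "continuous_map T euclideanreal c"
    and sel: "\<And>t. t \<in> topspace T \<Longrightarrow> f t \<in> fiber \<xi> t" and a: "a \<in> topspace T"
  shows "approx_cont (\<lambda>t. \<bar>c t\<bar> * e t) (\<lambda>t. bsmul \<xi> (of_real (c t)) (f t)) a"
  unfolding approx_cont_def
proof (intro allI impI)
  fix W assume W: "openin E W" "bsmul \<xi> (of_real (c a)) (f a) \<in> W"
  obtain C X where CX: "open C" "openin E X" "of_real (c a) \<in> C" "f a \<in> X"
    "\<And>d u. d \<in> C \<Longrightarrow> u \<in> X \<Longrightarrow> bsmul \<xi> d u \<in> W"
    using smul_nbhd[OF W fiberD(1)[OF sel[OF a]]] by metis
  have "open (of_real -` C :: real set)"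
    using CX(1) by (intro open_vimage continuous_intros)
  then have "openin T {t \<in> topspace T. c t \<in> of_real -` C}"
    by (intro openin_continuous_map_preimage[OF c]) simp
  then have "\<forall>\<^sub>F t in nhdsin T a. t \<in> {t \<in> topspace T. c t \<in> of_real -` C}"
    by (rule eventually_nhdsin_open) (use a CX(3) in auto)
  then show "\<forall>\<^sub>F t in nhdsin T a. \<exists>w\<in>W. proj \<xi> w = t \<and>
      bdist (bsmul \<xi> (of_real (c t)) (f t)) w \<le> \<bar>c t\<bar> * e t"
    using approx_contD[OF f CX(2,4)]
  proof eventually_elim
    case (elim t)
    then have t: "t \<in> topspace T" "of_real (c t) \<in> C" by auto
    from elim(2) obtain u where u: "u \<in> X" "proj \<xi> u = t" "bdist (f t) u \<le> e t"
      by blast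
    interpret V: banach_space_on "fiber \<xi> t" "badd \<xi>" "bsmul \<xi>" "borig \<xi> t" "bnorm \<xi>"
      by (rule fiber_banach[OF t(1)])
    have ut: "u \<in> fiber \<xi> t"
      using u openin_subset[OF CX(2)] by (auto simp: fiber_def)
    have "bdist (bsmul \<xi> (of_real (c t)) (f t)) (bsmul \<xi> (of_real (c t)) u) \<le> \<bar>c t\<bar> * e t"
      using V.vdist_smul[of "f t" u "of_real (c t)"] ut sel[OF t(1)] u(3)
      by (simp add: mult_left_mono)
    moreover have "proj \<xi> (bsmul \<xi> (of_real (c t)) u) = t"
      using V.smul_closed[OF ut] by (simp add: fiber_def)
    ultimately show ?case
      using CX(5)[OF t(2) u(1)] by blast
  qed
qed

text \<open>All the \<open>x i\<close> share the error \<open>e\<close>. Hence a combination with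
  nonnegative coefficients of sum at most 1 does not increase a nonnegative error, however many
  selections are averaged.\<close>

lemma approx_cont_lincomb:
  assumes "finite A" and "\<And>i. i \<in> A \<Longrightarrow> approx_cont e (x i) a"
    and "\<And>i. i \<in> A \<Longrightarrow> continuous_map T euclideanreal (c i)"
    and "\<And>i t. i \<in> A \<Longrightarrow> t \<in> topspace T \<Longrightarrow> x i t \<in> fiber \<xi> t" and a: "a \<in> topspace T"
  shows "approx_cont (\<lambda>t. (\<Sum>i\<in>A. \<bar>c i t\<bar>) * e t) (\<lambda>t. blincomb t (\<lambda>i. c i t) (\<lambda>i. x i t) A) a"
  using assms(1-4)
proof induction
  case empty
  have "\<forall>\<^sub>F t in nhdsin T a. borig \<xi> t = blincomb t (\<lambda>i. c i t) (\<lambda>i. x i t) {}"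
    using eventually_base
    by eventually_elim (simp add: banach_space_on.lincomb_empty[OF fiber_banach])
  then show ?case
    by (intro approx_cont_cong[OF approx_cont_borig[OF a]] a) simp_all
next
  case (insert i A)
  let ?L = "\<lambda>t. blincomb t (\<lambda>i. c i t) (\<lambda>i. x i t) A"
  have "approx_cont (\<lambda>t. \<bar>c i t\<bar> * e t + (\<Sum>i\<in>A. \<bar>c i t\<bar>) * e t)
      (\<lambda>t. badd \<xi> (bsmul \<xi> (of_real (c i t)) (x i t)) (?L t)) a"
  proof (rule approx_cont_add[OF _ _ _ _ a])
    show "approx_cont (\<lambda>t. \<bar>c i t\<bar> * e t) (\<lambda>t. bsmul \<xi> (of_real (c i t)) (x i t)) a"
      using insert.prems by (intro approx_cont_smul a) auto
    show "approx_cont (\<lambda>t. (\<Sum>i\<in>A. \<bar>c i t\<bar>) * e t) ?L a"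
      using insert by simp
    fix t assume t: "t \<in> topspace T"
    show "bsmul \<xi> (of_real (c i t)) (x i t) \<in> fiber \<xi> t"
      using insert.prems(3)[OF _ t] by (intro banach_space_on.smul_closed[OF fiber_banach[OF t]]) auto
    show "?L t \<in> fiber \<xi> t"
      using insert.prems(3)[OF _ t] by (intro banach_space_on.lincomb_closed[OF fiber_banach[OF t]]) auto
  qed
  moreover have "\<forall>\<^sub>F t in nhdsin T a. badd \<xi> (bsmul \<xi> (of_real (c i t)) (x i t)) (?L t)
      = blincomb t (\<lambda>i. c i t) (\<lambda>i. x i t) (insert i A)"
    using eventually_base
  proof eventually_elim
    case (elim t)
    then show ?case
      using insert.hyps insert.prems(3)
      by (subst banach_space_on.lincomb_insert[OF fiber_banach]) auto
  qed
  moreover have "\<forall>\<^sub>F t in nhdsin T a.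
      \<bar>c i t\<bar> * e t + (\<Sum>i\<in>A. \<bar>c i t\<bar>) * e t \<le> (\<Sum>i\<in>insert i A. \<bar>c i t\<bar>) * e t"
    using insert.hyps by (simp add: distrib_right)
  ultimately show ?case
    by (rule approx_cont_cong[OF _ _ _ a])
qed

text \<open>Triangle inequality along \<open>g t\<close>, \<open>f t\<close>, \<open>u\<close>,
  \<open>w\<close>, where \<open>u\<close> is near \<open>f a\<close> and \<open>w\<close> near
  \<open>g a\<close>. The outer two steps cost \<open>r\<close> each, the last because the bound at
  \<open>a\<close> persists on a neighbourhood of \<open>(f a, g a)\<close>; the middle one costs
  \<open>e\<close>.\<close>

lemma approx_cont_uniform_approx:
  assumes f: "approx_cont (\<lambda>_. e) f a"
    and sel: "\<And>t. t \<in> topspace T \<Longrightarrow> f t \<in> fiber \<xi> t" "\<And>t. t \<in> topspace T \<Longrightarrow> g t \<in> fiber \<xi> t"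
    and fg: "\<And>t. t \<in> topspace T \<Longrightarrow> bdist (f t) (g t) < r" and a: "a \<in> topspace T"
  shows "approx_cont (\<lambda>_. e + 2 * r) g a"
  unfolding approx_cont_def
proof (intro allI impI)
  fix W assume W: "openin E W" "g a \<in> W"
  obtain X Y where XY: "openin E X" "openin E Y" "f a \<in> X" "g a \<in> Y"
    "\<And>u v. u \<in> X \<Longrightarrow> v \<in> Y \<Longrightarrow> proj \<xi> u = proj \<xi> v \<Longrightarrow> bdist u v < r"
    by (rule dist_nbhd[OF sel[OF a, THEN fiberD(1)] same_proj[OF sel[OF a]] fg[OF a]]) blast
  \<comment> \<open>The witness must lie in \<open>Y\<close> as well, so that its distance to
    \<open>u\<close> is controlled.\<close>
  have "\<forall>\<^sub>F t in nhdsin T a. \<exists>w\<in>Y \<inter> W. proj \<xi> w = t"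
    using XY W sel(2)[OF a] by (intro eventually_proj_image[of _ "g a"]) (auto simp: fiber_def)
  then show "\<forall>\<^sub>F t in nhdsin T a. \<exists>w\<in>W. proj \<xi> w = t \<and> bdist (g t) w \<le> e + 2 * r"
    using approx_contD[OF f XY(1,3)] eventually_base
  proof eventually_elim
    case (elim t)
    then obtain u w where uw: "u \<in> X" "proj \<xi> u = t" "bdist (f t) u \<le> e"
        "w \<in> Y" "w \<in> W" "proj \<xi> w = t"
      by blast
    interpret V: banach_space_on "fiber \<xi> t" "badd \<xi>" "bsmul \<xi>" "borig \<xi> t" "bnorm \<xi>"
      by (rule fiber_banach[OF elim(3)])
    have uwt: "u \<in> fiber \<xi> t" "w \<in> fiber \<xi> t"
      using uw openin_subset[OF XY(1)] openin_subset[OF XY(2)] by (auto simp: fiber_def)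
    have "bdist (g t) w \<le> bdist (g t) (f t) + bdist (f t) w"
      using sel[OF elim(3)] uwt by (intro V.vdist_triangle)
    also have "bdist (f t) w \<le> bdist (f t) u + bdist u w"
      using sel[OF elim(3)] uwt by (intro V.vdist_triangle)
    also have "bdist (g t) (f t) = bdist (f t) (g t)"
      using sel[OF elim(3)] by (intro V.vdist_commute)
    finally have "bdist (g t) w \<le> e + 2 * r"
      using uw(3) fg[OF elim(3)] XY(5)[OF uw(1,4)] uw(2,6) by simp
    then show ?case
      using uw by blast
  qed
qed

text \<open>Write \<open>f t\<close> as \<open>w\<close> plus the difference of \<open>f t\<close>
  and \<open>w\<close>, with \<open>w\<close> near \<open>f a\<close>. The difference has small norm
  and is therefore near the origin of the fiber over \<open>a\<close>, so continuity of addition at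
  \<open>f a\<close> and that origin puts \<open>f t\<close> into \<open>W\<close>.\<close>

lemma approx_cont_imp_continuous_map:
  assumes f: "\<And>e a. 0 < e \<Longrightarrow> a \<in> topspace T \<Longrightarrow> approx_cont (\<lambda>_. e) f a"
    and sel: "\<And>t. t \<in> topspace T \<Longrightarrow> f t \<in> fiber \<xi> t"
  shows "continuous_map T E f"
  unfolding continuous_map_atin limitin_def
proof (intro ballI conjI allI impI; (elim conjE)?)
  fix a assume a: "a \<in> topspace T"
  then show fa: "f a \<in> topspace E"
    using sel by (simp add: fiber_def)
  fix W assume W: "openin E W" "f a \<in> W"
  interpret V: banach_space_on "fiber \<xi> a" "badd \<xi>" "bsmul \<xi>" "borig \<xi> a" "bnorm \<xi>"
    by (rule fiber_banach[OF a])
  have 0: "badd \<xi> (f a) (borig \<xi> a) \<in> W"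
    using W(2) sel[OF a] by (simp add: V.add_orig)
  obtain X Y where XY: "openin E X" "openin E Y" "f a \<in> X" "borig \<xi> a \<in> Y"
    "\<And>u v. u \<in> X \<Longrightarrow> v \<in> Y \<Longrightarrow> proj \<xi> u = proj \<xi> v \<Longrightarrow> badd \<xi> u v \<in> W"
    by (rule add_nbhd[OF W(1) 0 fa fiberD(1)[OF V.orig_closed] same_proj[OF sel[OF a] V.orig_closed]]) blast
  obtain d where d: "0 < d"
      "\<forall>\<^sub>F t in nhdsin T a. \<forall>x\<in>fiber \<xi> t. bnorm \<xi> x < d \<longrightarrow> x \<in> Y"
    by (rule zero_nbhd[OF XY(2,4) a])
  have "approx_cont (\<lambda>_. d / 2) f a"
    using d(1) a by (intro f) simp_all
  from approx_contD[OF this XY(1,3)] d(2) eventually_base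
  have "\<forall>\<^sub>F t in nhdsin T a. f t \<in> W"
  proof eventually_elim
    case (elim t)
    then obtain w where w: "w \<in> X" "proj \<xi> w = t" "bdist (f t) w \<le> d / 2"
      by blast
    interpret Vt: banach_space_on "fiber \<xi> t" "badd \<xi>" "bsmul \<xi>" "borig \<xi> t" "bnorm \<xi>"
      by (rule fiber_banach[OF elim(3)])
    have wt: "w \<in> fiber \<xi> t"
      using w openin_subset[OF XY(1)] by (auto simp: fiber_def)
    let ?z = "badd \<xi> (f t) (bsmul \<xi> (- 1) w)"
    have z: "?z \<in> fiber \<xi> t"
      using wt sel[OF elim(3)] by (intro Vt.closed)
    moreover have "bnorm \<xi> ?z < d"
      using w(3) d(1) by (simp add: Vt.vdist_def)
    ultimately have "?z \<in> Y"
      using elim(2) by blast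
    then have "badd \<xi> w ?z \<in> W"
      using XY(5)[OF w(1)] w(2) z by (simp add: fiber_def)
    then show "f t \<in> W"
      using Vt.minus_add_cancel[OF sel[OF elim(3)] wt] by simp
  qed
  then show "\<forall>\<^sub>F t in atin T a. f t \<in> W"
    unfolding atin_def by (rule filter_leD[OF inf_le1])
qed

text \<open>
  A local selection \<open>s V\<close> is only under control on \<open>V\<close>. Near a point \<open>a\<close> the average of the \<open>s V\<close> does
  not involve those with \<open>a \<notin> V\<close>, because the support of \<open>\<psi> V\<close> has its closure in \<open>V\<close>.
\<close>

lemma glue_approx_cont_selections:
  assumes T: "paracompact_space T" and e: "0 \<le> e"
    and C: "\<And>t. t \<in> topspace T \<Longrightarrow> C t \<subseteq> fiber \<xi> t"
    and convex: "\<And>t A (c :: 't set \<Rightarrow> real) x. t \<in> topspace T \<Longrightarrow> finite A \<Longrightarrow>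
      (\<And>i. i \<in> A \<Longrightarrow> 0 \<le> c i) \<Longrightarrow> sum c A = 1 \<Longrightarrow> (\<And>i. i \<in> A \<Longrightarrow> x i \<in> C t) \<Longrightarrow>
      blincomb t c x A \<in> C t"
    and loc: "\<And>a. a \<in> topspace T \<Longrightarrow> \<exists>N s. openin T N \<and> a \<in> N \<and>
      (\<forall>t\<in>topspace T. s t \<in> C t) \<and> (\<forall>t\<in>N. approx_cont (\<lambda>_. e) s t)"
  obtains f where "\<And>t. t \<in> topspace T \<Longrightarrow> f t \<in> C t"
    "\<And>t. t \<in> topspace T \<Longrightarrow> approx_cont (\<lambda>_. e) f t"
proof -
  define \<U> where "\<U> = {N. openin T N \<and>
    (\<exists>s. (\<forall>t\<in>topspace T. s t \<in> C t) \<and> (\<forall>t\<in>N. approx_cont (\<lambda>_. e) s t))}"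
  have "\<And>U. U \<in> \<U> \<Longrightarrow> openin T U"
    by (simp add: \<U>_def)
  moreover have "\<Union>\<U> = topspace T"
  proof
    show "\<Union>\<U> \<subseteq> topspace T"
      by (auto simp: \<U>_def dest: openin_subset)
    show "topspace T \<subseteq> \<Union>\<U>"
    proof
      fix a assume "a \<in> topspace T"
      then show "a \<in> \<Union>\<U>"
        using loc[of a] unfolding \<U>_def by blast
    qed
  qed
  ultimately obtain \<V> and \<psi> :: "'t set \<Rightarrow> 't \<Rightarrow> real"
    where \<V>: "\<And>V. V \<in> \<V> \<Longrightarrow> \<exists>U\<in>\<U>. V \<subseteq> U" "locally_finite_in T \<V>"
      and \<psi>: "\<And>V. V \<in> \<V> \<Longrightarrow> continuous_map T euclideanreal (\<psi> V)"
        "\<And>V x. V \<in> \<V> \<Longrightarrow> x \<in> topspace T \<Longrightarrow> 0 \<le> \<psi> V x"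
        "\<And>V. V \<in> \<V> \<Longrightarrow> T closure_of {x \<in> topspace T. \<psi> V x \<noteq> 0} \<subseteq> V"
        "\<And>x. x \<in> topspace T \<Longrightarrow> (\<Sum>V | V \<in> \<V> \<and> x \<in> V. \<psi> V x) = 1"
    by (rule paracompact_space_partition_of_unity[OF T]) blast+
  have "\<exists>s. (\<forall>t\<in>topspace T. s t \<in> C t) \<and> (\<forall>t\<in>V. approx_cont (\<lambda>_. e) s t)" if "V \<in> \<V>" for V
    using \<V>(1)[OF that] unfolding \<U>_def by blast
  then obtain s where s: "\<And>V t. V \<in> \<V> \<Longrightarrow> t \<in> topspace T \<Longrightarrow> s V t \<in> C t"
      "\<And>V t. V \<in> \<V> \<Longrightarrow> t \<in> V \<Longrightarrow> approx_cont (\<lambda>_. e) (s V) t"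
    by metis
  have s_fiber: "s V t \<in> fiber \<xi> t" if "V \<in> \<V>" "t \<in> topspace T" for V t
    using s(1)[OF that] C[OF that(2)] by blast
  have \<psi>_zero: "\<psi> V t = 0" if "V \<in> \<V>" "t \<in> topspace T"
    "t \<notin> T closure_of {x \<in> topspace T. \<psi> V x \<noteq> 0}" for V t
    using that closure_of_subset[of "{x \<in> topspace T. \<psi> V x \<noteq> 0}" T] by blast
  define f where "f t = blincomb t (\<lambda>V. \<psi> V t) (\<lambda>V. s V t) {V \<in> \<V>. t \<in> V}" for t
  show thesis
  proof (rule that)
    fix t assume t: "t \<in> topspace T"
    show "f t \<in> C t"
      unfolding f_def using t \<psi>(2,4) s(1) locally_finite_in_finite_at[OF \<V>(2) t]
      by (intro convex) auto
  next
    fix a assume a: "a \<in> topspace T"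
    obtain N where N: "openin T N" "a \<in> N" "finite {V \<in> \<V>. V \<inter> N \<noteq> {}}"
      using \<V>(2) a unfolding locally_finite_in_def by blast
    let ?supp = "\<lambda>V. T closure_of {x \<in> topspace T. \<psi> V x \<noteq> 0}"
    define B where "B = {V \<in> \<V>. a \<in> V}"
    \<comment> \<open>Finitely many closed sets are removed. None contains \<open>a\<close>, because
      each lies in a member of the cover that omits \<open>a\<close>; so \<open>N'\<close> is an
      open neighbourhood of \<open>a\<close>.\<close>
    define N' where "N' = N - (\<Union>V\<in>{V \<in> \<V>. V \<inter> N \<noteq> {} \<and> a \<notin> V}. ?supp V)"
    have fB: "finite B"
      unfolding B_def by (rule locally_finite_in_finite_at[OF \<V>(2) a])
    have "closedin T (\<Union>V\<in>{V \<in> \<V>. V \<inter> N \<noteq> {} \<and> a \<notin> V}. ?supp V)"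
      using N(3)
      by (intro closedin_Union finite_imageI) (auto intro: rev_finite_subset)
    then have "openin T N'"
      unfolding N'_def using N(1) by (rule openin_diff[rotated])
    moreover have "a \<in> N'"
      using N(2) \<psi>(3) by (auto simp: N'_def)
    ultimately have ev: "\<forall>\<^sub>F t in nhdsin T a. t \<in> N'"
      by (rule eventually_nhdsin_open)
    \<comment> \<open>Over \<open>N'\<close> the coefficient of \<open>V\<close> vanishes unless
      \<open>V\<close> contains both \<open>a\<close> and \<open>t\<close>. So the fixed index set
      \<open>B\<close> and the varying one in \<open>f\<close> can both be replaced by their
      intersection.\<close>
    have zero: "\<psi> V t = 0"
      if "t \<in> N'" "t \<in> topspace T" "V \<in> \<V>" "t \<notin> V \<or> V \<notin> B" for V t
    proof (rule \<psi>_zero[OF that(3,2)])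
      show "t \<notin> ?supp V"
      proof
        assume t: "t \<in> ?supp V"
        then have "t \<in> V"
          using \<psi>(3)[OF that(3)] by blast
        then have "V \<inter> N \<noteq> {} \<and> a \<notin> V"
          using that by (auto simp: N'_def B_def)
        then show False
          using t that(1,3) unfolding N'_def by blast
      qed
    qed
    have "approx_cont (\<lambda>t. (\<Sum>V\<in>B. \<bar>\<psi> V t\<bar>) * e) (\<lambda>t. blincomb t (\<lambda>V. \<psi> V t) (\<lambda>V. s V t) B) a"
      using \<psi>(1) s(2) s_fiber by (intro approx_cont_lincomb fB a) (auto simp: B_def)
    moreover have "\<forall>\<^sub>F t in nhdsin T a. blincomb t (\<lambda>V. \<psi> V t) (\<lambda>V. s V t) B = f t"
      using ev eventually_base
    proof eventually_elim
      case (elim t)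
      interpret V: banach_space_on "fiber \<xi> t" "badd \<xi>" "bsmul \<xi>" "borig \<xi> t" "bnorm \<xi>"
        by (rule fiber_banach[OF elim(2)])
      let ?A = "{V \<in> \<V>. t \<in> V}"
      have fA: "finite ?A"
        by (rule locally_finite_in_finite_at[OF \<V>(2) elim(2)])
      have "V.lincomb (\<lambda>V. \<psi> V t) (\<lambda>V. s V t) (B \<inter> ?A) = V.lincomb (\<lambda>V. \<psi> V t) (\<lambda>V. s V t) B"
        using fB zero[OF elim] s_fiber[OF _ elim(2)]
        by (intro V.lincomb_mono_neutral) (auto simp: B_def)
      moreover have "V.lincomb (\<lambda>V. \<psi> V t) (\<lambda>V. s V t) (B \<inter> ?A) = V.lincomb (\<lambda>V. \<psi> V t) (\<lambda>V. s V t) ?A"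
        using fA zero[OF elim] s_fiber[OF _ elim(2)]
        by (intro V.lincomb_mono_neutral) auto
      ultimately show ?case
        by (simp add: f_def)
    qed
    moreover have "\<forall>\<^sub>F t in nhdsin T a. (\<Sum>V\<in>B. \<bar>\<psi> V t\<bar>) * e \<le> e"
      using ev eventually_base
    proof eventually_elim
      case (elim t)
      let ?A = "{V \<in> \<V>. t \<in> V}"
      have "(\<Sum>V\<in>B. \<bar>\<psi> V t\<bar>) = (\<Sum>V\<in>B. \<psi> V t)"
        using \<psi>(2) elim(2) by (intro sum.cong) (auto simp: B_def)
      also have "\<dots> = (\<Sum>V\<in>B \<inter> ?A. \<psi> V t)"
        using fB zero[OF elim] by (intro sum.mono_neutral_right) (auto simp: B_def)
      also have "\<dots> \<le> (\<Sum>V\<in>?A. \<psi> V t)"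
        using locally_finite_in_finite_at[OF \<V>(2) elim(2)] \<psi>(2) elim(2)
        by (intro sum_mono2) auto
      also have "\<dots> = 1"
        using \<psi>(4)[OF elim(2)] by simp
      finally show ?case
        using mult_right_mono[of "\<Sum>V\<in>B. \<bar>\<psi> V t\<bar>" 1 e] e by simp
    qed
    ultimately show "approx_cont (\<lambda>_. e) f a"
      by (rule approx_cont_cong[OF _ _ _ a])
  qed
qed

end

section \<open>Lifting sections\<close>

locale banach_bundle_quotient =
  B1: banach_bundle \<xi>\<^sub>1 + B2: banach_bundle \<xi>\<^sub>2
  for \<xi>\<^sub>1 :: "('k::real_or_complex, 'e, 't) bundle_data"
    and \<xi>\<^sub>2 :: "('k, 'f, 't) bundle_data" +
  fixes \<phi> :: "'e \<Rightarrow> 'f"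
  assumes bundle_map: "banach_bundle_map \<xi>\<^sub>1 \<xi>\<^sub>2 \<phi>"
    and open_map: "open_map (tot_space \<xi>\<^sub>1) (tot_space \<xi>\<^sub>2) \<phi>"
    and surj: "\<phi> ` topspace (tot_space \<xi>\<^sub>1) = topspace (tot_space \<xi>\<^sub>2)"
begin

lemma base_eq: "base_space \<xi>\<^sub>2 = B1.T"
  using bundle_map by (simp add: banach_bundle_map_def)

lemma continuous: "continuous_map B1.E B2.E \<phi>"
  using bundle_map by (simp add: banach_bundle_map_def)

lemma map_fiber: "t \<in> topspace B1.T \<Longrightarrow> x \<in> fiber \<xi>\<^sub>1 t \<Longrightarrow> \<phi> x \<in> fiber \<xi>\<^sub>2 t"
  using bundle_map by (simp add: banach_bundle_map_def image_subset_iff)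

lemma map_badd:
  "t \<in> topspace B1.T \<Longrightarrow> x \<in> fiber \<xi>\<^sub>1 t \<Longrightarrow> y \<in> fiber \<xi>\<^sub>1 t \<Longrightarrow> \<phi> (badd \<xi>\<^sub>1 x y) = badd \<xi>\<^sub>2 (\<phi> x) (\<phi> y)"
  using bundle_map by (simp add: banach_bundle_map_def)

lemma map_bsmul:
  "t \<in> topspace B1.T \<Longrightarrow> x \<in> fiber \<xi>\<^sub>1 t \<Longrightarrow> \<phi> (bsmul \<xi>\<^sub>1 c x) = bsmul \<xi>\<^sub>2 c (\<phi> x)"
  using bundle_map by (simp add: banach_bundle_map_def)

lemma proj_map:
  assumes "x \<in> topspace B1.E"
  shows "proj \<xi>\<^sub>2 (\<phi> x) = proj \<xi>\<^sub>1 x"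
  using map_fiber[OF B1.proj_in_base[OF assms] B1.fiberI[OF assms refl]] by (simp add: fiber_def)

text \<open>\<phi> preserves projections, so any preimage of \<open>y\<close> already lies in the
  correct fiber.\<close>

lemma fiber_surj:
  assumes "y \<in> fiber \<xi>\<^sub>2 t"
  obtains x where "x \<in> fiber \<xi>\<^sub>1 t" "\<phi> x = y"
proof -
  have "y \<in> \<phi> ` topspace B1.E"
    using assms surj by (simp add: fiber_def)
  then obtain x where "x \<in> topspace B1.E" "\<phi> x = y"
    by blast
  then show thesis
    using proj_map[of x] assms by (intro that[of x]) (auto simp: fiber_def)
qed

lemma fiber_banach1: "t \<in> topspace B1.T \<Longrightarrow>
    banach_space_on (fiber \<xi>\<^sub>1 t) (badd \<xi>\<^sub>1) (bsmul \<xi>\<^sub>1) (borig \<xi>\<^sub>1 t) (bnorm \<xi>\<^sub>1)"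
  by (rule B1.fiber_banach)

lemma fiber_banach2: "t \<in> topspace B1.T \<Longrightarrow>
    banach_space_on (fiber \<xi>\<^sub>2 t) (badd \<xi>\<^sub>2) (bsmul \<xi>\<^sub>2) (borig \<xi>\<^sub>2 t) (bnorm \<xi>\<^sub>2)"
  using B2.fiber_banach by (simp add: base_eq)

lemma map_borig:
  assumes t: "t \<in> topspace B1.T"
  shows "\<phi> (borig \<xi>\<^sub>1 t) = borig \<xi>\<^sub>2 t"
proof -
  interpret V: banach_space_on "fiber \<xi>\<^sub>1 t" "badd \<xi>\<^sub>1" "bsmul \<xi>\<^sub>1" "borig \<xi>\<^sub>1 t" "bnorm \<xi>\<^sub>1"
    by (rule fiber_banach1[OF t])
  interpret W: banach_space_on "fiber \<xi>\<^sub>2 t" "badd \<xi>\<^sub>2" "bsmul \<xi>\<^sub>2" "borig \<xi>\<^sub>2 t" "bnorm \<xi>\<^sub>2"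
    by (rule fiber_banach2[OF t])
  show ?thesis
    using map_bsmul[OF t V.orig_closed, of 0] map_fiber[OF t V.orig_closed]
    by (simp add: V.smul_orig W.smul_zero)
qed

lemma map_lincomb:
  assumes t: "t \<in> topspace B1.T" and A: "finite A" "\<And>i. i \<in> A \<Longrightarrow> x i \<in> fiber \<xi>\<^sub>1 t"
  shows "\<phi> (B1.blincomb t c x A) = B2.blincomb t c (\<lambda>i. \<phi> (x i)) A"
proof -
  interpret V: banach_space_on "fiber \<xi>\<^sub>1 t" "badd \<xi>\<^sub>1" "bsmul \<xi>\<^sub>1" "borig \<xi>\<^sub>1 t" "bnorm \<xi>\<^sub>1"
    by (rule fiber_banach1[OF t])
  interpret W: banach_space_on "fiber \<xi>\<^sub>2 t" "badd \<xi>\<^sub>2" "bsmul \<xi>\<^sub>2" "borig \<xi>\<^sub>2 t" "bnorm \<xi>\<^sub>2"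
    by (rule fiber_banach2[OF t])
  show ?thesis
    using A
  proof induction
    case (insert i A)
    then have i: "x i \<in> fiber \<xi>\<^sub>1 t" and L: "V.lincomb c x A \<in> fiber \<xi>\<^sub>1 t"
      and \<phi>x: "\<And>j. j \<in> insert i A \<Longrightarrow> \<phi> (x j) \<in> fiber \<xi>\<^sub>2 t"
      using map_fiber[OF t] by (auto intro: V.lincomb_closed)
    have "\<phi> (V.lincomb c x (insert i A))
        = badd \<xi>\<^sub>2 (bsmul \<xi>\<^sub>2 (of_real (c i)) (\<phi> (x i))) (\<phi> (V.lincomb c x A))"
      using V.lincomb_insert[OF insert.hyps insert.prems]
      by (simp add: map_badd[OF t V.smul_closed[OF i] L] map_bsmul[OF t i])
    then show ?case
      using insert.IH[OF insert.prems] W.lincomb_insert[OF insert.hyps \<phi>x] by simp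
  qed (simp add: map_borig[OF t])
qed

lemma map_bdist:
  assumes t: "t \<in> topspace B1.T" and xy: "x \<in> fiber \<xi>\<^sub>1 t" "y \<in> fiber \<xi>\<^sub>1 t"
  shows "bnorm \<xi>\<^sub>2 (\<phi> (badd \<xi>\<^sub>1 x (bsmul \<xi>\<^sub>1 (- 1) y))) = B2.bdist (\<phi> x) (\<phi> y)"
proof -
  interpret V: banach_space_on "fiber \<xi>\<^sub>1 t" "badd \<xi>\<^sub>1" "bsmul \<xi>\<^sub>1" "borig \<xi>\<^sub>1 t" "bnorm \<xi>\<^sub>1"
    by (rule fiber_banach1[OF t])
  show ?thesis
    using xy
    by (simp add: map_badd[OF t] map_bsmul[OF t] V.closed
        banach_space_on.vdist_def[OF fiber_banach2[OF t]])
qed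

text \<open>Closedness of the set of lifts in a fiber. As the bundle spaces may fail to be
  Hausdorff, limits are compared through the norm: the preimage of an open norm ball is open and
  contains the origin, so differences of small norm have images of norm below
  \<open>r\<close>.\<close>

lemma map_limit:
  assumes t: "t \<in> topspace B1.T" and x: "\<And>n. x n \<in> fiber \<xi>\<^sub>1 t" "\<And>n. \<phi> (x n) = y"
    and l: "l \<in> fiber \<xi>\<^sub>1 t" "(\<lambda>n. B1.bdist (x n) l) \<longlonglongrightarrow> 0"
  shows "\<phi> l = y"
proof -
  interpret V: banach_space_on "fiber \<xi>\<^sub>1 t" "badd \<xi>\<^sub>1" "bsmul \<xi>\<^sub>1" "borig \<xi>\<^sub>1 t" "bnorm \<xi>\<^sub>1"
    by (rule fiber_banach1[OF t])
  interpret W: banach_space_on "fiber \<xi>\<^sub>2 t" "badd \<xi>\<^sub>2" "bsmul \<xi>\<^sub>2" "borig \<xi>\<^sub>2 t" "bnorm \<xi>\<^sub>2"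
    by (rule fiber_banach2[OF t])
  have y: "y \<in> fiber \<xi>\<^sub>2 t"
    using map_fiber[OF t x(1)[of 0]] x(2)[of 0] by simp
  have "W.vdist y (\<phi> l) \<le> r" if "0 < r" for r
  proof -
    let ?B = "{z \<in> topspace B2.E. bnorm \<xi>\<^sub>2 z < r}"
    let ?W = "{x \<in> topspace B1.E. \<phi> x \<in> ?B}"
    have "openin B1.E ?W"
      by (rule openin_continuous_map_preimage[OF continuous B2.norm_upper_semicontinuous])
    moreover have "borig \<xi>\<^sub>1 t \<in> ?W"
      using V.orig_closed W.orig_closed W.nrm_orig that by (simp add: map_borig[OF t] fiber_def)
    ultimately obtain d where d: "0 < d"
      "\<forall>\<^sub>F t in nhdsin B1.T t. \<forall>x\<in>fiber \<xi>\<^sub>1 t. bnorm \<xi>\<^sub>1 x < d \<longrightarrow> x \<in> ?W"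
      using t by (rule B1.zero_nbhd)
    \<comment> \<open>A property holding eventually near \<open>t\<close> holds in particular over
      \<open>t\<close> itself.\<close>
    then have small: "z \<in> ?W" if "z \<in> fiber \<xi>\<^sub>1 t" "bnorm \<xi>\<^sub>1 z < d" for z
      using t that by (auto simp: eventually_nhdsin)
    have "\<forall>\<^sub>F n in sequentially. B1.bdist (x n) l < d"
      using order_tendstoD(2)[OF l(2) d(1)] .
    then obtain n where n: "B1.bdist (x n) l < d"
      by (auto simp: eventually_sequentially)
    then have "badd \<xi>\<^sub>1 (x n) (bsmul \<xi>\<^sub>1 (- 1) l) \<in> ?W"
      using x(1) l(1) by (intro small V.closed) (auto simp: V.vdist_def)
    then show ?thesis
      using map_bdist[OF t x(1) l(1), of n] x(2) by simp
  qed
  then have "W.vdist y (\<phi> l) \<le> 0"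
    by (rule field_le_epsilon[of _ 0, simplified])
  then show ?thesis
    using W.vdist_nonneg[OF y map_fiber[OF t l(1)]] W.vdist_eq_0[OF y map_fiber[OF t l(1)]] by simp
qed

end

section \<open>Approximate selections among the lifts of a section\<close>

locale section_lifting = banach_bundle_quotient \<xi>\<^sub>1 \<xi>\<^sub>2 \<phi>
  for \<xi>\<^sub>1 :: "('k::real_or_complex, 'e, 't) bundle_data"
    and \<xi>\<^sub>2 :: "('k, 'f, 't) bundle_data"
    and \<phi> :: "'e \<Rightarrow> 'f" +
  fixes g :: "'t \<Rightarrow> 'f"
  assumes paracompact: "paracompact_space B1.T"
    and g_section: "g \<in> sections \<xi>\<^sub>2"
begin

lemma g_fiber: "t \<in> topspace B1.T \<Longrightarrow> g t \<in> fiber \<xi>\<^sub>2 t"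
  using g_section by (auto simp: sections_def fiber_def base_eq continuous_map_def Pi_iff)

lemma g_continuous: "continuous_map B1.T B2.E g"
  using g_section by (simp add: sections_def base_eq)

definition lifts :: "'t \<Rightarrow> 'e set" where
  "lifts t = {x \<in> fiber \<xi>\<^sub>1 t. \<phi> x = g t}"

lemma lifts_nonempty:
  assumes "t \<in> topspace B1.T"
  obtains x where "x \<in> lifts t"
  using fiber_surj[OF g_fiber[OF assms]] unfolding lifts_def by blast

text \<open>By linearity \<phi> maps the combination to the same combination of the constant
  \<open>g t\<close>, which is \<open>g t\<close> since the coefficients sum to 1.\<close>

lemma lifts_convex:
  assumes t: "t \<in> topspace B1.T" and A: "finite A" "sum c A = 1" "\<And>i. i \<in> A \<Longrightarrow> x i \<in> lifts t"
  shows "B1.blincomb t c x A \<in> lifts t"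
proof -
  interpret V: banach_space_on "fiber \<xi>\<^sub>1 t" "badd \<xi>\<^sub>1" "bsmul \<xi>\<^sub>1" "borig \<xi>\<^sub>1 t" "bnorm \<xi>\<^sub>1"
    by (rule fiber_banach1[OF t])
  interpret W: banach_space_on "fiber \<xi>\<^sub>2 t" "badd \<xi>\<^sub>2" "bsmul \<xi>\<^sub>2" "borig \<xi>\<^sub>2 t" "bnorm \<xi>\<^sub>2"
    by (rule fiber_banach2[OF t])
  have x: "x i \<in> fiber \<xi>\<^sub>1 t" "\<phi> (x i) = g t" if "i \<in> A" for i
    using A(3)[OF that] by (auto simp: lifts_def)
  have "\<phi> (V.lincomb c x A) = W.lincomb c (\<lambda>i. \<phi> (x i)) A"
    by (rule map_lincomb[OF t A(1) x(1)])
  also have "\<dots> = W.lincomb c (\<lambda>_. g t) A"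
    using x(2) g_fiber[OF t] by (intro W.lincomb_cong)
  also have "\<dots> = g t"
    using A g_fiber[OF t] by (simp add: W.lincomb_const W.smul_one)
  finally show ?thesis
    using V.lincomb_closed[of A x c] x(1) by (simp add: lifts_def)
qed

text \<open>
  Openness of \<open>\<phi>\<close> supplies lifts in \<open>U\<close> over all points near \<open>a\<close>; since \<open>U\<close> is thin, no choice of
  these lifts can oscillate by more than \<open>e\<close>.
\<close>

lemma local_selection:
  assumes a: "a \<in> topspace B1.T" and U: "openin B1.E U" "x \<in> U" "x \<in> lifts a"
    and thin: "\<And>u v. u \<in> U \<Longrightarrow> v \<in> U \<Longrightarrow> proj \<xi>\<^sub>1 u = proj \<xi>\<^sub>1 v \<Longrightarrow> B1.bdist u v < e"
  obtains N s where "openin B1.T N" "a \<in> N" "\<And>t. t \<in> N \<Longrightarrow> s t \<in> U \<inter> lifts t"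
    "\<And>t h. t \<in> N \<Longrightarrow> (\<And>t. t \<in> N \<Longrightarrow> h t = s t) \<Longrightarrow> B1.approx_cont (\<lambda>_. e) h t"
proof -
  define N where "N = {t \<in> topspace B1.T. g t \<in> \<phi> ` U}"
  have "openin B2.E (\<phi> ` U)"
    using open_map U(1) by (simp add: open_map_def)
  then have N: "openin B1.T N"
    unfolding N_def by (rule openin_continuous_map_preimage[OF g_continuous])
  have "\<exists>u. u \<in> U \<inter> lifts t" if t: "t \<in> N" for t
  proof -
    obtain u where u: "u \<in> U" "\<phi> u = g t"
      using t by (auto simp: N_def)
    moreover have "u \<in> topspace B1.E"
      using u(1) openin_subset[OF U(1)] by blast
    moreover have "proj \<xi>\<^sub>2 (g t) = t"
      using t g_fiber[of t] by (auto simp: N_def fiber_def)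
    ultimately show ?thesis
      using proj_map[of u] by (auto simp: lifts_def fiber_def)
  qed
  then obtain s where s: "\<And>t. t \<in> N \<Longrightarrow> s t \<in> U \<inter> lifts t"
    by metis
  show thesis
  proof (rule that[OF N _ s])
    have "\<phi> x = g a"
      using U(3) by (simp add: lifts_def)
    then show "a \<in> N"
      using a U(2) unfolding N_def by force
    fix b h assume b: "b \<in> N" and h: "\<And>t. t \<in> N \<Longrightarrow> h t = s t"
    show "B1.approx_cont (\<lambda>_. e) h b"
      unfolding B1.approx_cont_def
    proof (intro allI impI)
      fix W assume W: "openin B1.E W" "h b \<in> W"
      \<comment> \<open>Both \<open>w\<close> and \<open>h t\<close> will lie in \<open>U\<close>,
        so thinness alone bounds their distance.\<close>
      have "\<forall>\<^sub>F t in nhdsin B1.T b. \<exists>w\<in>W \<inter> U. proj \<xi>\<^sub>1 w = t"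
        using W(1) U(1) W(2) s[OF b] h[OF b]
        by (intro B1.eventually_proj_image[of _ "h b"]) (auto simp: lifts_def fiber_def)
      then show "\<forall>\<^sub>F t in nhdsin B1.T b. \<exists>w\<in>W. proj \<xi>\<^sub>1 w = t \<and> B1.bdist (h t) w \<le> e"
        using B1.eventually_nhdsin_open[OF N b]
      proof eventually_elim
        case (elim t)
        then obtain w where w: "w \<in> W" "w \<in> U" "proj \<xi>\<^sub>1 w = t"
          by blast
        have "h t \<in> U" "proj \<xi>\<^sub>1 (h t) = t"
          using s[OF elim(2)] h[OF elim(2)] by (auto simp: lifts_def fiber_def)
        then have "B1.bdist (h t) w < e"
          using thin w by simp
        then show ?case
          using w by force
      qed
    qed
  qed
qed

text \<open>Common form of the initial step, where \<open>C t\<close> consists of all lifts, and of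
  the improvement step, where it consists of the lifts near a previous selection. The sets
  \<open>C\<close> are convex for families indexed by sets of base points because the partition of
  unity is indexed by a cover.\<close>

lemma approx_selection:
  assumes e: "0 < e"
    and C: "\<And>t. t \<in> topspace B1.T \<Longrightarrow> C t \<subseteq> lifts t" "\<And>t. t \<in> topspace B1.T \<Longrightarrow> C t \<noteq> {}"
    and convex: "\<And>t A (c :: 't set \<Rightarrow> real) x. t \<in> topspace B1.T \<Longrightarrow> finite A \<Longrightarrow>
      (\<And>i. i \<in> A \<Longrightarrow> 0 \<le> c i) \<Longrightarrow> sum c A = 1 \<Longrightarrow> (\<And>i. i \<in> A \<Longrightarrow> x i \<in> C t) \<Longrightarrow>
      B1.blincomb t c x A \<in> C t"
    and near: "\<And>a. a \<in> topspace B1.T \<Longrightarrow> \<exists>x\<in>lifts a. \<exists>U. openin B1.E U \<and> x \<in> U \<and>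
      (\<forall>\<^sub>F t in nhdsin B1.T a. U \<inter> lifts t \<subseteq> C t)"
  obtains f where "\<And>t. t \<in> topspace B1.T \<Longrightarrow> f t \<in> C t"
    "\<And>t. t \<in> topspace B1.T \<Longrightarrow> B1.approx_cont (\<lambda>_. e) f t"
proof (rule B1.glue_approx_cont_selections[OF paracompact, of e C])
  show "0 \<le> e"
    using e by simp
  show "C t \<subseteq> fiber \<xi>\<^sub>1 t" if "t \<in> topspace B1.T" for t
    using C(1)[OF that] by (auto simp: lifts_def)
  show "B1.blincomb t c x A \<in> C t" if "t \<in> topspace B1.T" "finite A" "\<And>i. i \<in> A \<Longrightarrow> 0 \<le> c i"
    "sum c A = 1" "\<And>i. i \<in> A \<Longrightarrow> x i \<in> C t" for t A and c :: "'t set \<Rightarrow> real" and x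
    using that by (rule convex)
  fix a assume a: "a \<in> topspace B1.T"
  obtain x U where xU: "x \<in> lifts a" "openin B1.E U" "x \<in> U"
      "\<forall>\<^sub>F t in nhdsin B1.T a. U \<inter> lifts t \<subseteq> C t"
    using near[OF a] by blast
  obtain M where M: "openin B1.T M" "a \<in> M" "\<And>t. t \<in> M \<Longrightarrow> U \<inter> lifts t \<subseteq> C t"
    using xU(4) a by (auto simp: eventually_nhdsin)
  have "x \<in> topspace B1.E"
    using xU(1) by (simp add: lifts_def fiber_def)
  then obtain U' where U': "openin B1.E U'" "x \<in> U'"
    "\<And>u v. u \<in> U' \<Longrightarrow> v \<in> U' \<Longrightarrow> proj \<xi>\<^sub>1 u = proj \<xi>\<^sub>1 v \<Longrightarrow> B1.bdist u v < e"
    using e by (rule B1.thin_nbhd) blast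
  obtain N s where Ns: "openin B1.T N" "a \<in> N" "\<And>t. t \<in> N \<Longrightarrow> s t \<in> (U \<inter> U') \<inter> lifts t"
    "\<And>t h. t \<in> N \<Longrightarrow> (\<And>t. t \<in> N \<Longrightarrow> h t = s t) \<Longrightarrow> B1.approx_cont (\<lambda>_. e) h t"
  proof (rule local_selection[OF a, of "U \<inter> U'" x e])
    show "B1.bdist u v < e" if "u \<in> U \<inter> U'" "v \<in> U \<inter> U'" "proj \<xi>\<^sub>1 u = proj \<xi>\<^sub>1 v" for u v
      using U'(3) that by blast
  qed (use xU U' in auto)
  \<comment> \<open>Gluing needs local selections with values in \<open>C\<close> over the whole
    base; away from \<open>N \<inter> M\<close> any element of \<open>C t\<close> will do.\<close>
  define h where "h t = (if t \<in> N \<inter> M then s t else SOME x. x \<in> C t)" for t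
  show "\<exists>N s. openin B1.T N \<and> a \<in> N \<and> (\<forall>t\<in>topspace B1.T. s t \<in> C t) \<and>
      (\<forall>t\<in>N. B1.approx_cont (\<lambda>_. e) s t)"
  proof (intro exI[of _ "N \<inter> M"] exI[of _ h] conjI ballI)
    show "h t \<in> C t" if "t \<in> topspace B1.T" for t
      using Ns(3) M(3) C(2)[OF that] by (auto simp: h_def some_in_eq)
    fix t assume t: "t \<in> N \<inter> M"
    have tT: "t \<in> topspace B1.T"
      using t openin_subset[OF M(1)] by blast
    have "B1.approx_cont (\<lambda>_. e) s t"
      using t by (intro Ns(4)) auto
    moreover have "\<forall>\<^sub>F t in nhdsin B1.T t. s t = h t"
      using B1.eventually_nhdsin_open[OF openin_Int[OF Ns(1) M(1)] t]
      by eventually_elim (simp add: h_def)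
    ultimately show "B1.approx_cont (\<lambda>_. e) h t"
      by (rule B1.approx_cont_cong[OF _ _ _ tT]) simp
  qed (use Ns M in auto)
qed (rule that)

section \<open>Successive approximation\<close>

lemma initial_selection:
  obtains f where "\<And>t. t \<in> topspace B1.T \<Longrightarrow> f t \<in> lifts t"
    "\<And>t. t \<in> topspace B1.T \<Longrightarrow> B1.approx_cont (\<lambda>_. 1) f t"
proof (rule approx_selection[of 1 lifts])
  show "lifts t \<noteq> {}" if "t \<in> topspace B1.T" for t
    using lifts_nonempty[OF that] by blast
  show "\<exists>x\<in>lifts a. \<exists>U. openin B1.E U \<and> x \<in> U \<and> (\<forall>\<^sub>F t in nhdsin B1.T a. U \<inter> lifts t \<subseteq> lifts t)"
    if a: "a \<in> topspace B1.T" for a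
  proof -
    obtain x where "x \<in> lifts a"
      by (rule lifts_nonempty[OF a])
    then show ?thesis
      \<comment> \<open>With no previous selection to stay close to, the whole bundle space serves
        as \<open>U\<close>.\<close>
      by (intro bexI[of _ x] exI[of _ "topspace B1.E"]) (auto simp: lifts_def fiber_def)
  qed
  show "B1.blincomb t c x A \<in> lifts t"
    if "t \<in> topspace B1.T" "finite A" "sum c A = 1" "\<And>i. i \<in> A \<Longrightarrow> x i \<in> lifts t"
    for t A and c :: "'t set \<Rightarrow> real" and x
    using that by (rule lifts_convex)
qed (use that in auto)

text \<open>Take \<open>U\<close> around \<open>f a\<close> with fiberwise diameter below
  \<open>e\<close>. For \<open>t\<close> near \<open>a\<close> some point of \<open>U\<close> over
  \<open>t\<close> is within \<open>e\<close> of \<open>f t\<close>, and every lift in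
  \<open>U\<close> is within \<open>e\<close> of that point. Hence all lifts in \<open>U\<close>
  satisfy the bound \<open>2 * e\<close>, whatever new accuracy \<open>d\<close> is
  requested.\<close>

lemma improve_selection:
  assumes f: "\<And>t. t \<in> topspace B1.T \<Longrightarrow> f t \<in> lifts t"
      "\<And>t. t \<in> topspace B1.T \<Longrightarrow> B1.approx_cont (\<lambda>_. e) f t"
    and e: "0 < e" and d: "0 < d"
  obtains f' where "\<And>t. t \<in> topspace B1.T \<Longrightarrow> f' t \<in> lifts t"
    "\<And>t. t \<in> topspace B1.T \<Longrightarrow> B1.approx_cont (\<lambda>_. d) f' t"
    "\<And>t. t \<in> topspace B1.T \<Longrightarrow> B1.bdist (f t) (f' t) \<le> 2 * e"
proof (rule approx_selection[OF d, of "\<lambda>t. {x \<in> lifts t. B1.bdist (f t) x \<le> 2 * e}"])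
  have lifts_fiber: "x \<in> fiber \<xi>\<^sub>1 t" if "x \<in> lifts t" for x t
    using that by (simp add: lifts_def)
  {
    fix t assume t: "t \<in> topspace B1.T"
    interpret V: banach_space_on "fiber \<xi>\<^sub>1 t" "badd \<xi>\<^sub>1" "bsmul \<xi>\<^sub>1" "borig \<xi>\<^sub>1 t" "bnorm \<xi>\<^sub>1"
      by (rule fiber_banach1[OF t])
    have "f t \<in> {x \<in> lifts t. B1.bdist (f t) x \<le> 2 * e}"
      using V.vdist_self[OF lifts_fiber[OF f(1)[OF t]]] f(1)[OF t] e by simp
    then show "{x \<in> lifts t. B1.bdist (f t) x \<le> 2 * e} \<noteq> {}" by blast
    show "B1.blincomb t c x A \<in> {x \<in> lifts t. B1.bdist (f t) x \<le> 2 * e}"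
      if "finite A" "\<And>i. i \<in> A \<Longrightarrow> 0 \<le> c i" "sum c A = 1"
        "\<And>i. i \<in> A \<Longrightarrow> x i \<in> {x \<in> lifts t. B1.bdist (f t) x \<le> 2 * e}"
      for A and c :: "'t set \<Rightarrow> real" and x
      using lifts_convex[OF t that(1,3), of x] V.vdist_convex_comb_le[OF that(1) _ _ that(2,3), of x "f t" "2 * e"]
        that(4) lifts_fiber f(1)[OF t] by simp
  }
  fix a assume a: "a \<in> topspace B1.T"
  have fa: "f a \<in> topspace B1.E"
    using f(1)[OF a] by (simp add: lifts_def fiber_def)
  obtain U where U: "openin B1.E U" "f a \<in> U"
    "\<And>u v. u \<in> U \<Longrightarrow> v \<in> U \<Longrightarrow> proj \<xi>\<^sub>1 u = proj \<xi>\<^sub>1 v \<Longrightarrow> B1.bdist u v < e"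
    by (rule B1.thin_nbhd[OF fa e]) blast
  have "\<forall>\<^sub>F t in nhdsin B1.T a. U \<inter> lifts t \<subseteq> {x \<in> lifts t. B1.bdist (f t) x \<le> 2 * e}"
    using B1.approx_contD[OF f(2)[OF a] U(1,2)] B1.eventually_base
  proof eventually_elim
    case (elim t)
    interpret V: banach_space_on "fiber \<xi>\<^sub>1 t" "badd \<xi>\<^sub>1" "bsmul \<xi>\<^sub>1" "borig \<xi>\<^sub>1 t" "bnorm \<xi>\<^sub>1"
      by (rule fiber_banach1[OF elim(2)])
    obtain w where w: "w \<in> U" "proj \<xi>\<^sub>1 w = t" "B1.bdist (f t) w \<le> e"
      using elim(1) by blast
    have wt: "w \<in> fiber \<xi>\<^sub>1 t"
      using w openin_subset[OF U(1)] by (auto simp: fiber_def)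
    show ?case
    proof (intro subsetI CollectI conjI; elim IntE)
      fix x assume x: "x \<in> U" "x \<in> lifts t"
      have xt: "x \<in> fiber \<xi>\<^sub>1 t"
        by (rule lifts_fiber[OF x(2)])
      have "B1.bdist (f t) x \<le> B1.bdist (f t) w + B1.bdist w x"
        by (rule V.vdist_triangle[OF lifts_fiber[OF f(1)[OF elim(2)]] wt xt])
      also have "B1.bdist w x < e"
        by (rule U(3)[OF w(1) x(1) B1.same_proj[OF wt xt]])
      finally show "B1.bdist (f t) x \<le> 2 * e"
        using w(3) by simp
    qed
  qed
  then show "\<exists>x\<in>lifts a. \<exists>U. openin B1.E U \<and> x \<in> U \<and>
      (\<forall>\<^sub>F t in nhdsin B1.T a. U \<inter> lifts t \<subseteq> {x \<in> lifts t. B1.bdist (f t) x \<le> 2 * e})"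
    using f(1)[OF a] U(1,2) by blast
qed (use that in auto)

lemma selection_sequence:
  obtains f where "\<And>n t. t \<in> topspace B1.T \<Longrightarrow> f n t \<in> lifts t"
    "\<And>n t. t \<in> topspace B1.T \<Longrightarrow> B1.approx_cont (\<lambda>_. (1/2) ^ n) (f n) t"
    "\<And>n t. t \<in> topspace B1.T \<Longrightarrow> B1.bdist (f n t) (f (Suc n) t) \<le> 2 * (1/2) ^ n"
proof -
  let ?P = "\<lambda>n f. (\<forall>t\<in>topspace B1.T. f t \<in> lifts t) \<and>
    (\<forall>t\<in>topspace B1.T. B1.approx_cont (\<lambda>_. (1/2) ^ n) f t)"
  let ?Q = "\<lambda>n f f'. \<forall>t\<in>topspace B1.T. B1.bdist (f t) (f' t) \<le> 2 * (1/2) ^ n"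
  have "\<exists>f. ?P 0 f"
    by (rule initial_selection) auto
  moreover have "\<exists>f'. ?P (Suc n) f' \<and> ?Q n f f'" if f: "?P n f" for n f
  proof -
    obtain f' where "\<And>t. t \<in> topspace B1.T \<Longrightarrow> f' t \<in> lifts t"
      "\<And>t. t \<in> topspace B1.T \<Longrightarrow> B1.approx_cont (\<lambda>_. (1/2) ^ Suc n) f' t"
      "\<And>t. t \<in> topspace B1.T \<Longrightarrow> B1.bdist (f t) (f' t) \<le> 2 * (1/2) ^ n"
    proof (rule improve_selection[of f "(1/2) ^ n" "(1/2) ^ Suc n"])
      show "f t \<in> lifts t" "B1.approx_cont (\<lambda>_. (1/2) ^ n) f t" if "t \<in> topspace B1.T" for t
        using that f by auto
    qed (use that in auto)
    then show ?thesis by blast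
  qed
  \<comment> \<open>Dependent choice: each selection is built from its predecessor.\<close>
  ultimately obtain f where "\<And>n. ?P n (f n)" "\<And>n. ?Q n (f n) (f (Suc n))"
    by (rule dependent_nat_choice[of ?P ?Q, elim_format]) blast+
  then show thesis
    by (intro that[of f]) auto
qed

text \<open>In each complete fiber the sequence converges, and its limit is again a lift because
  lifts are closed under limits. The geometric bounds do not depend on \<open>t\<close>, so the
  limit is approximately continuous for every positive error, hence continuous.\<close>

lemma lift_section:
  obtains f where "continuous_map B1.T B1.E f" "\<And>t. t \<in> topspace B1.T \<Longrightarrow> f t \<in> lifts t"
proof -
  obtain f where f: "\<And>n t. t \<in> topspace B1.T \<Longrightarrow> f n t \<in> lifts t"
    "\<And>n t. t \<in> topspace B1.T \<Longrightarrow> B1.approx_cont (\<lambda>_. (1/2) ^ n) (f n) t"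
    "\<And>n t. t \<in> topspace B1.T \<Longrightarrow> B1.bdist (f n t) (f (Suc n) t) \<le> 2 * (1/2) ^ n"
    by (rule selection_sequence) blast
  have "\<exists>l\<in>lifts t. \<forall>n. B1.bdist (f n t) l \<le> 4 * (1/2) ^ n" if t: "t \<in> topspace B1.T" for t
  proof -
    interpret V: banach_space_on "fiber \<xi>\<^sub>1 t" "badd \<xi>\<^sub>1" "bsmul \<xi>\<^sub>1" "borig \<xi>\<^sub>1 t" "bnorm \<xi>\<^sub>1"
      by (rule fiber_banach1[OF t])
    have ft: "f n t \<in> fiber \<xi>\<^sub>1 t" "\<phi> (f n t) = g t" for n
      using f(1)[OF t, of n] by (auto simp: lifts_def)
    \<comment> \<open>The right-hand side is the exact value of the sum of
      \<open>2 * (1/2) ^ j\<close> for \<open>j\<close> from \<open>n\<close> to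
      \<open>n + k - 1\<close>, which lets the induction close.\<close>
    have step: "V.vdist (f n t) (f (n + k) t) \<le> 4 * (1/2) ^ n - 4 * (1/2) ^ (n + k)" for n k
    proof (induction k)
      case (Suc k)
      have "V.vdist (f n t) (f (n + Suc k) t)
          \<le> V.vdist (f n t) (f (n + k) t) + V.vdist (f (n + k) t) (f (Suc (n + k)) t)"
        using V.vdist_triangle[OF ft(1) ft(1) ft(1)] by simp
      then show ?case
        using Suc f(3)[OF t, of "n + k"] by simp
    qed (simp add: V.vdist_self ft)
    have cauchy: "V.vdist (f n t) (f m t) \<le> 4 * (1/2) ^ n" if "n \<le> m" for n m
    proof -
      have "V.vdist (f n t) (f m t) \<le> 4 * (1/2) ^ n - 4 * (1/2) ^ m"
        using step[of n "m - n"] that by simp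
      moreover have "0 \<le> 4 * (1/2::real) ^ m" by simp
      ultimately show ?thesis by linarith
    qed
    have "\<exists>N. \<forall>m\<ge>N. \<forall>n\<ge>N. V.vdist (f m t) (f n t) < e" if e: "0 < e" for e
    proof -
      \<comment> \<open>Both terms lie within \<open>4 * (1/2) ^ N\<close> of the
        \<open>N\<close>-th one, which makes \<open>8 * (1/2) ^ N\<close> in total.\<close>
      obtain N where N: "(1/2) ^ N < e / 8"
        using real_arch_pow_inv[of "e / 8" "1/2"] e by auto
      show ?thesis
      proof (intro exI allI impI)
        fix m n assume "N \<le> m" "N \<le> n"
        then have "V.vdist (f m t) (f N t) \<le> 4 * (1/2) ^ N" "V.vdist (f N t) (f n t) \<le> 4 * (1/2) ^ N"
          using cauchy V.vdist_commute[OF ft(1) ft(1)] by auto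
        then show "V.vdist (f m t) (f n t) < e"
          using V.vdist_triangle[OF ft(1)[of m] ft(1)[of N] ft(1)[of n]] N by linarith
      qed
    qed
    then obtain l where l: "l \<in> fiber \<xi>\<^sub>1 t" "(\<lambda>n. V.vdist (f n t) l) \<longlonglongrightarrow> 0"
      by (rule V.complete_vdist[OF ft(1)])
    \<comment> \<open>The Cauchy bound passes to the limit: let \<open>m\<close> tend to infinity in
      the triangle inequality through \<open>f m t\<close>.\<close>
    have "V.vdist (f n t) l \<le> 4 * (1/2) ^ n" for n
    proof (rule tendsto_lowerbound[OF tendsto_add[OF tendsto_const l(2), of "4 * (1/2) ^ n", simplified]])
      show "\<forall>\<^sub>F m in sequentially. V.vdist (f n t) l \<le> 4 * (1/2) ^ n + V.vdist (f m t) l"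
        using eventually_ge_at_top[of n]
      proof eventually_elim
        case (elim m)
        then show ?case
          using V.vdist_triangle[OF ft(1)[of n] ft(1)[of m] l(1)] cauchy[of n m] by linarith
      qed
    qed simp
    moreover have "\<phi> l = g t"
      by (rule map_limit[OF t ft l])
    ultimately show ?thesis
      using l(1) by (auto simp: lifts_def)
  qed
  then obtain h where h: "\<And>t. t \<in> topspace B1.T \<Longrightarrow> h t \<in> lifts t"
      "\<And>t n. t \<in> topspace B1.T \<Longrightarrow> B1.bdist (f n t) (h t) \<le> 4 * (1/2) ^ n"
    by metis
  show thesis
  proof (rule that[OF _ h(1)])
    show "continuous_map B1.T B1.E h"
    proof (rule B1.approx_cont_imp_continuous_map)
      show "h t \<in> fiber \<xi>\<^sub>1 t" if "t \<in> topspace B1.T" for t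
        using h(1)[OF that] by (simp add: lifts_def)
      fix e a assume e: "0 < (e::real)" and a: "a \<in> topspace B1.T"
      \<comment> \<open>Uniform approximation asks for a strict bound, so the factor 4 is relaxed to
        5; the resulting error is 1 + 2 * 5 = 11 times \<open>(1/2) ^ n\<close>.\<close>
      obtain n where n: "(1/2) ^ n < e / 11"
        using real_arch_pow_inv[of "e / 11" "1/2"] e by auto
      have "B1.approx_cont (\<lambda>_. (1/2) ^ n + 2 * (5 * (1/2) ^ n)) h a"
      proof (rule B1.approx_cont_uniform_approx[OF f(2)[OF a]])
        fix t assume t: "t \<in> topspace B1.T"
        show "f n t \<in> fiber \<xi>\<^sub>1 t" "h t \<in> fiber \<xi>\<^sub>1 t"
          using f(1)[OF t] h(1)[OF t] by (auto simp: lifts_def)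
        show "B1.bdist (f n t) (h t) < 5 * (1/2) ^ n"
          using h(2)[OF t, of n] zero_less_power[of "1/2::real" n] by linarith
      qed (rule a)
      then show "B1.approx_cont (\<lambda>_. e) h a"
        by (rule B1.approx_cont_cong) (use n a in auto)
    qed
  qed
qed

end

theorem theorem3p2:
  fixes T :: "'t topology"
    and \<xi>\<^sub>1 :: "('k::real_or_complex, 'e, 't) bundle_data"
    and \<xi>\<^sub>2 :: "('k, 'f, 't) bundle_data"
    and \<phi> :: "'e \<Rightarrow> 'f"
  assumes "paracompact_space T"
    and "banach_bundle \<xi>\<^sub>1" and "base_space \<xi>\<^sub>1 = T"
    and "banach_bundle \<xi>\<^sub>2" and "base_space \<xi>\<^sub>2 = T"
    and "banach_bundle_map \<xi>\<^sub>1 \<xi>\<^sub>2 \<phi>"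
    and "open_map (tot_space \<xi>\<^sub>1) (tot_space \<xi>\<^sub>2) \<phi>"
    and "\<phi> ` topspace (tot_space \<xi>\<^sub>1) = topspace (tot_space \<xi>\<^sub>2)"
  shows "induced_map \<xi>\<^sub>1 \<phi> ` sections \<xi>\<^sub>1 = sections \<xi>\<^sub>2"
proof -
  interpret banach_bundle_quotient \<xi>\<^sub>1 \<xi>\<^sub>2 \<phi>
    using assms by (intro banach_bundle_quotient.intro banach_bundle_quotient_axioms.intro)
  show ?thesis
  proof (intro subset_antisym subsetI)
    fix h assume "h \<in> induced_map \<xi>\<^sub>1 \<phi> ` sections \<xi>\<^sub>1"
    then obtain f where f: "continuous_map B1.T B1.E f" "\<And>t. t \<in> topspace B1.T \<Longrightarrow> proj \<xi>\<^sub>1 (f t) = t"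
        and h: "h = (\<lambda>t\<in>topspace B1.T. \<phi> (f t))"
      by (auto simp: sections_def induced_map_def)
    have "continuous_map B1.T B2.E h"
      by (rule continuous_map_eq[OF continuous_map_compose[OF f(1) continuous]]) (simp add: h)
    moreover have "proj \<xi>\<^sub>2 (h t) = t" if "t \<in> topspace B1.T" for t
    proof -
      have "f t \<in> topspace B1.E"
        using f(1) that by (auto simp: continuous_map_def)
      then show ?thesis
        using f(2)[OF that] proj_map[of "f t"] that by (simp add: h)
    qed
    ultimately show "h \<in> sections \<xi>\<^sub>2"
      by (auto simp: sections_def base_eq h)
  next
    fix g assume g: "g \<in> sections \<xi>\<^sub>2"
    interpret section_lifting \<xi>\<^sub>1 \<xi>\<^sub>2 \<phi> g
      using assms g by unfold_locales simp_all
    obtain f where f: "continuous_map B1.T B1.E f" "\<And>t. t \<in> topspace B1.T \<Longrightarrow> f t \<in> lifts t"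
      by (rule lift_section) blast
    \<comment> \<open>Sections must be \<open>undefined\<close> off the base space; restricting
      there changes neither continuity nor the values on the base.\<close>
    let ?f = "restrict f (topspace B1.T)"
    have "continuous_map B1.T B1.E ?f"
      by (rule continuous_map_eq[OF f(1)]) simp
    then have "?f \<in> sections \<xi>\<^sub>1"
      using f(2) by (auto simp: sections_def lifts_def fiber_def)
    moreover have "g \<in> extensional (topspace B1.T)"
      using g by (simp add: sections_def base_eq)
    then have "g = induced_map \<xi>\<^sub>1 \<phi> ?f"
      using f(2) by (intro extensionalityI[of _ "topspace B1.T"]) (auto simp: induced_map_def lifts_def)
    ultimately show "g \<in> induced_map \<xi>\<^sub>1 \<phi> ` sections \<xi>\<^sub>1"
      by blast
  qed
qed

end
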